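(* Let $\tilde M_1,\tilde M_2$ be two complete locally compact CAT(0)-spaces, and assume that $\phi:\tilde M_1\to\tilde M_2$ is a quasi-isometry. Let $k\ge 1$, let $\gamma\subset\tilde M_1$ be a $k$-flat, let $X_1=\mathrm{Cone}(\tilde M_1)$ be an asymptotic cone of $\tilde M_1$ and $\gamma_\omega\subset X_1$ the corresponding $k$-flat, and assume that there exists a bi-Lipschitz $(k+1)$-dimensional half-flat $F\subset X_1$ bounding the $k$-flat $\gamma_\omega\subset X_1$. Then at least one of the following holds: (1) (Non-periodicity) every $k$-flat $\eta\subset\tilde M_2$ at bounded distance from $\phi(\gamma)$ has the property that $\eta/\mathrm{Stab}_G(\eta)$ is non-compact, where $G=\mathrm{Isom}(\tilde M_2)$; or (2) (Bounding) every $k$-flat $\eta\subset\tilde M_2$ at bounded distance from $\phi(\gamma)$ bounds a $(k+1)$-dimensional half-flat in $\tilde M_2$.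
   Context: Flats and half-flats. A $k$-flat ($k\ge1$) in a CAT(0)-space is an isometrically embedded copy of the standard Euclidean space $\mathbb{R}^k$ (for $k=1$: a bi-infinite geodesic). A $(k+1)$-dimensional half-flat is an isometrically embedded copy of $\mathbb{R}^{k}\times[0,\infty)$. A $k$-flat $\eta$ bounds a $(k+1)$-dimensional half-flat if there is an isometric embedding of $\mathbb{R}^k\times[0,\infty)$ into the space mapping $\mathbb{R}^k\times\{0\}$ onto $\eta$. A bi-Lipschitz $(k+1)$-dimensional half-flat $F$ bounding $\gamma_\omega$ is the image of a bi-Lipschitz embedding $\mathbb{R}^k\times[0,\infty)\to X_1$ whose restriction to $\mathbb{R}^k\times\{0\}$ is a homeomorphism onto $\gamma_\omega$. "At bounded distance" means at finite Hausdorff distance. $\mathrm{Stab}_G(\eta)$ is the subgroup of elements $g\in G$ with $g(\eta)=\eta$. Quasi-isometries. A (not necessarily continuous) map $\phi:(X,d_X)\to(Y,d_Y)$ is $(C,K)$-quasi-isometric if $\frac1C d_X(p,q)-K\le d_Y(\phi(p),\phi(q))\le C d_X(p,q)+K$ for all $p,q$; a quasi-isometry is such a map whose image is, in addition, coarsely dense (every point of $Y$ is within a uniform distance of the image). Asymptotic cones. Let $\omega$ be a non-principal ultrafilter on $\mathbb{N}$, let $(M,d,* )$ be a pointed metric space, and let $\lambda_j\in(0,\infty)$ be a sequence of scaling factors with $\omega\lim\lambda_j=\infty$. For sequences $\{x_j\},\{y_j\}$ in $M$ set $d_\omega(\{x_j\},\{y_j\})=\omega\lim d(x_j,y_j)/\lambda_j\in[0,\infty]$.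 The asymptotic cone $\mathrm{Cone}(M)$ is the set of sequences $\{x_j\}$ with $d_\omega(\{x_j\},\{*\})<\infty$, modulo identifying sequences at $d_\omega$-distance $0$, with metric $d_\omega$. If $\gamma\subset M$ is a $k$-flat, $\gamma_\omega\subset\mathrm{Cone}(M)$ is the set of points represented by sequences of points in $\gamma$; it is a $k$-flat when $M$ is CAT(0). *)

theory Defs
  imports "HOL-Analysis.Analysis" "HOL-Algebra.Group_Action"
begin

section \<open>Maps between metric spaces\<close>

definition isometric_embedding :: "'a metric \<Rightarrow> 'b metric \<Rightarrow> ('a \<Rightarrow> 'b) \<Rightarrow> bool" where
  "isometric_embedding m m' f \<longleftrightarrow>
     f \<in> mspace m \<rightarrow> mspace m' \<and>
     (\<forall>x\<in>mspace m. \<forall>y\<in>mspace m. mdist m' (f x) (f y) = mdist m x y)"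

definition bilipschitz_embedding :: "'a metric \<Rightarrow> 'b metric \<Rightarrow> ('a \<Rightarrow> 'b) \<Rightarrow> bool" where
  "bilipschitz_embedding m m' f \<longleftrightarrow>
     f \<in> mspace m \<rightarrow> mspace m' \<and>
     (\<exists>L\<ge>1. \<forall>x\<in>mspace m. \<forall>y\<in>mspace m.
        mdist m x y / L \<le> mdist m' (f x) (f y) \<and> mdist m' (f x) (f y) \<le> L * mdist m x y)"

definition quasi_isometric_map :: "real \<Rightarrow> real \<Rightarrow> 'a metric \<Rightarrow> 'b metric \<Rightarrow> ('a \<Rightarrow> 'b) \<Rightarrow> bool" where
  "quasi_isometric_map C K m m' \<phi> \<longleftrightarrow>
     \<phi> \<in> mspace m \<rightarrow> mspace m' \<and>
     (\<forall>p\<in>mspace m. \<forall>q\<in>mspace m.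
        1 / C * mdist m p q - K \<le> mdist m' (\<phi> p) (\<phi> q) \<and>
        mdist m' (\<phi> p) (\<phi> q) \<le> C * mdist m p q + K)"

definition quasi_isometry :: "'a metric \<Rightarrow> 'b metric \<Rightarrow> ('a \<Rightarrow> 'b) \<Rightarrow> bool" where
  "quasi_isometry m m' \<phi> \<longleftrightarrow>
     (\<exists>C\<ge>1. \<exists>K\<ge>0. quasi_isometric_map C K m m' \<phi>) \<and>
     (\<exists>D. \<forall>y\<in>mspace m'. \<exists>x\<in>mspace m. mdist m' y (\<phi> x) \<le> D)"

definition hausdorff_distance :: "'a metric \<Rightarrow> 'a set \<Rightarrow> 'a set \<Rightarrow> ennreal" where
  "hausdorff_distance m S T =
     max (SUP x\<in>S. INF y\<in>T. ennreal (mdist m x y)) (SUP y\<in>T. INF x\<in>S. ennreal (mdist m x y))"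

section \<open>CAT(0) spaces\<close>

definition geodesic_segment :: "'a metric \<Rightarrow> 'a \<Rightarrow> 'a \<Rightarrow> 'a set \<Rightarrow> bool" where
  "geodesic_segment m x y S \<longleftrightarrow>
     (\<exists>l\<ge>0. \<exists>c::real \<Rightarrow> 'a. isometric_embedding (submetric euclidean_metric {0..l}) m c \<and>
        c 0 = x \<and> c l = y \<and> c ` {0..l} = S)"

text \<open>\<open>a'\<close>, on the Euclidean segment from \<open>p'\<close> to \<open>q'\<close>, is the comparison point of \<open>a\<close>,
  on the geodesic segment \<open>S\<close> issuing from \<open>p\<close>.\<close>

definition comparison_point ::
  "'a metric \<Rightarrow> 'a \<Rightarrow> 'a set \<Rightarrow> real^2 \<Rightarrow> real^2 \<Rightarrow> 'a \<Rightarrow> real^2 \<Rightarrow> bool" where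
  "comparison_point m p S p' q' a a' \<longleftrightarrow>
     a \<in> S \<and> a' \<in> closed_segment p' q' \<and> dist p' a' = mdist m p a"

definition CAT0 :: "'a metric \<Rightarrow> bool" where
  "CAT0 m \<longleftrightarrow>
     (\<forall>x\<in>mspace m. \<forall>y\<in>mspace m. \<exists>S. geodesic_segment m x y S) \<and>
     (\<forall>p\<in>mspace m. \<forall>q\<in>mspace m. \<forall>r\<in>mspace m. \<forall>S1 S2 S3. \<forall>p' q' r'.
        geodesic_segment m p q S1 \<longrightarrow> geodesic_segment m q r S2 \<longrightarrow> geodesic_segment m r p S3 \<longrightarrow>
        dist p' q' = mdist m p q \<longrightarrow> dist q' r' = mdist m q r \<longrightarrow> dist r' p' = mdist m r p \<longrightarrow>
        (let cmp = (\<lambda>a a'. comparison_point m p S1 p' q' a a' \<or>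
                           comparison_point m q S2 q' r' a a' \<or>
                           comparison_point m r S3 r' p' a a')
         in \<forall>a b a' b'. cmp a a' \<longrightarrow> cmp b b' \<longrightarrow> mdist m a b \<le> dist a' b'))"

section \<open>Flats and half-flats\<close>

text \<open>The dimension \<open>k \<ge> 1\<close> is the cardinality of the finite type \<open>'k\<close>.  Products of
  Euclidean spaces carry the \<open>L\<^sup>2\<close> product distance, so \<open>half_space\<close> has its Euclidean metric.\<close>

definition half_space :: "((real^'k::finite) \<times> real) metric" where
  "half_space = submetric euclidean_metric (UNIV \<times> {0..})"

definition is_flat :: "'k::finite itself \<Rightarrow> 'a metric \<Rightarrow> 'a set \<Rightarrow> bool" where
  "is_flat TYPE('k) m S \<longleftrightarrow>
     (\<exists>f::real^'k \<Rightarrow> 'a. isometric_embedding euclidean_metric m f \<and> range f = S)"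

definition bounds_half_flat :: "'k::finite itself \<Rightarrow> 'a metric \<Rightarrow> 'a set \<Rightarrow> bool" where
  "bounds_half_flat TYPE('k) m \<eta> \<longleftrightarrow>
     (\<exists>h::(real^'k) \<times> real \<Rightarrow> 'a. isometric_embedding half_space m h \<and> h ` (UNIV \<times> {0}) = \<eta>)"

definition bilipschitz_half_flat_bounding ::
  "'k::finite itself \<Rightarrow> 'a metric \<Rightarrow> 'a set \<Rightarrow> 'a set \<Rightarrow> bool" where
  "bilipschitz_half_flat_bounding TYPE('k) m F \<eta> \<longleftrightarrow>
     (\<exists>h::(real^'k) \<times> real \<Rightarrow> 'a.
        bilipschitz_embedding half_space m h \<and> h ` mspace half_space = F \<and>
        homeomorphic_map (top_of_set (UNIV \<times> {0})) (subtopology (mtopology_of m) \<eta>) h)"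

section \<open>Isometry groups and orbit spaces\<close>

definition isometry_group :: "'a metric \<Rightarrow> ('a \<Rightarrow> 'a) monoid" where
  "isometry_group m = (BijGroup (mspace m))
     \<lparr>carrier := {g \<in> Bij (mspace m). isometric_embedding m m g}\<rparr>"

definition stab :: "'a metric \<Rightarrow> 'a set \<Rightarrow> ('a \<Rightarrow> 'a) set" where
  "stab m \<eta> = stabilizer (isometry_group m) (\<lambda>g S. g ` S) \<eta>"

definition quotient_topology :: "'a topology \<Rightarrow> ('a \<Rightarrow> 'b) \<Rightarrow> 'b topology" where
  "quotient_topology X q =
     topology (\<lambda>U. U \<subseteq> q ` topspace X \<and> openin X {x \<in> topspace X. q x \<in> U})"

lemma openin_quotient_topology:
  "openin (quotient_topology X q) U \<longleftrightarrow>
     U \<subseteq> q ` topspace X \<and> openin X {x \<in> topspace X. q x \<in> U}"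
proof -
  have "istopology (\<lambda>U. U \<subseteq> q ` topspace X \<and> openin X {x \<in> topspace X. q x \<in> U})"
  proof (unfold istopology_def, intro conjI allI impI)
    fix S T
    assume "S \<subseteq> q ` topspace X \<and> openin X {x \<in> topspace X. q x \<in> S}"
      and "T \<subseteq> q ` topspace X \<and> openin X {x \<in> topspace X. q x \<in> T}"
    moreover have "{x \<in> topspace X. q x \<in> S \<inter> T} =
        {x \<in> topspace X. q x \<in> S} \<inter> {x \<in> topspace X. q x \<in> T}" by auto
    ultimately show "S \<inter> T \<subseteq> q ` topspace X" "openin X {x \<in> topspace X. q x \<in> S \<inter> T}"
      by auto
  next
    fix \<K>
    assume *: "\<forall>K\<in>\<K>. K \<subseteq> q ` topspace X \<and> openin X {x \<in> topspace X. q x \<in> K}"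
    have "{x \<in> topspace X. q x \<in> \<Union>\<K>} = (\<Union>K\<in>\<K>. {x \<in> topspace X. q x \<in> K})" by auto
    with * show "openin X {x \<in> topspace X. q x \<in> \<Union>\<K>}" by auto
    from * show "\<Union>\<K> \<subseteq> q ` topspace X" by auto
  qed
  then show ?thesis by (simp add: quotient_topology_def)
qed

lemma topspace_quotient_topology [simp]:
  "topspace (quotient_topology X q) = q ` topspace X"
proof
  show "topspace (quotient_topology X q) \<subseteq> q ` topspace X"
    by (metis openin_quotient_topology openin_topspace)
  have "{x \<in> topspace X. q x \<in> q ` topspace X} = topspace X" by auto
  then have "openin (quotient_topology X q) (q ` topspace X)"
    by (simp add: openin_quotient_topology)
  then show "q ` topspace X \<subseteq> topspace (quotient_topology X q)"
    by (rule openin_subset)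
qed

lemma quotient_map_quotient_topology: "quotient_map X (quotient_topology X q) q"
  unfolding quotient_map_def
  by (simp add: openin_quotient_topology)

definition flat_quotient :: "'a metric \<Rightarrow> 'a set \<Rightarrow> 'a set topology" where
  "flat_quotient m \<eta> = quotient_topology (subtopology (mtopology_of m) \<eta>)
     (orbit ((isometry_group m)\<lparr>carrier := stab m \<eta>\<rparr>) (\<lambda>g. g))"

section \<open>Asymptotic cones\<close>

definition nonprincipal_ultrafilter :: "'i filter \<Rightarrow> bool" where
  "nonprincipal_ultrafilter \<omega> \<longleftrightarrow>
     \<omega> \<noteq> bot \<and>
     (\<forall>P. eventually P \<omega> \<or> eventually (\<lambda>i. \<not> P i) \<omega>) \<and>
     (\<forall>i. \<not> eventually (\<lambda>j. j = i) \<omega>)"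

definition seq_dist ::
  "nat filter \<Rightarrow> (nat \<Rightarrow> real) \<Rightarrow> 'a metric \<Rightarrow> (nat \<Rightarrow> 'a) \<Rightarrow> (nat \<Rightarrow> 'a) \<Rightarrow> ennreal" where
  "seq_dist \<omega> scal m x y = Lim \<omega> (\<lambda>j. ennreal (mdist m (x j) (y j) / scal j))"

definition cone_seqs ::
  "nat filter \<Rightarrow> (nat \<Rightarrow> real) \<Rightarrow> 'a metric \<Rightarrow> 'a \<Rightarrow> (nat \<Rightarrow> 'a) set" where
  "cone_seqs \<omega> scal m p =
     {x. (\<forall>j. x j \<in> mspace m) \<and> seq_dist \<omega> scal m x (\<lambda>_. p) < \<infinity>}"

definition cone_rel ::
  "nat filter \<Rightarrow> (nat \<Rightarrow> real) \<Rightarrow> 'a metric \<Rightarrow> 'a \<Rightarrow> ((nat \<Rightarrow> 'a) \<times> (nat \<Rightarrow> 'a)) set" where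
  "cone_rel \<omega> scal m p =
     {(x, y) \<in> cone_seqs \<omega> scal m p \<times> cone_seqs \<omega> scal m p. seq_dist \<omega> scal m x y = 0}"

definition asymptotic_cone ::
  "nat filter \<Rightarrow> (nat \<Rightarrow> real) \<Rightarrow> 'a metric \<Rightarrow> 'a \<Rightarrow> (nat \<Rightarrow> 'a) set metric" where
  "asymptotic_cone \<omega> scal m p =
     metric (cone_seqs \<omega> scal m p // cone_rel \<omega> scal m p,
       \<lambda>A B. enn2real (seq_dist \<omega> scal m (SOME x. x \<in> A) (SOME y. y \<in> B)))"

definition cone_subset ::
  "nat filter \<Rightarrow> (nat \<Rightarrow> real) \<Rightarrow> 'a metric \<Rightarrow> 'a \<Rightarrow> 'a set \<Rightarrow> (nat \<Rightarrow> 'a) set set" where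
  "cone_subset \<omega> scal m p S =
     {A \<in> mspace (asymptotic_cone \<omega> scal m p). \<exists>x\<in>A. \<forall>j. x j \<in> S}"

text \<open>The remaining facts show that the pair passed to \<^const>\<open>metric\<close> in \<open>asymptotic_cone\<close>
  is a metric space, so that this constructor is not applied outside its domain.\<close>

lemma ultrafilter_Lim:
  fixes f :: "'i \<Rightarrow> ennreal"
  assumes "nonprincipal_ultrafilter \<omega>"
  shows "(f \<longlongrightarrow> Lim \<omega> f) \<omega>"
proof -
  have nb: "\<omega> \<noteq> bot" and u: "\<And>P. eventually P \<omega> \<or> eventually (\<lambda>i. \<not> P i) \<omega>"
    using assms by (auto simp: nonprincipal_ultrafilter_def)
  have "filtermap f \<omega> \<noteq> bot" using nb by (simp add: filtermap_bot_iff)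
  moreover have "compact (UNIV :: ennreal set)" by (rule compact_UNIV)
  ultimately obtain l where l: "inf (nhds l) (filtermap f \<omega>) \<noteq> bot"
    by (auto simp: compact_filter)
  have "(f \<longlongrightarrow> l) \<omega>"
  proof (rule topological_tendstoI)
    fix S assume S: "open S" "l \<in> S"
    show "eventually (\<lambda>x. f x \<in> S) \<omega>"
    proof (rule ccontr)
      assume "\<not> ?thesis"
      then have "eventually (\<lambda>x. f x \<notin> S) \<omega>" using u by blast
      then have "eventually (\<lambda>x. x \<notin> S) (filtermap f \<omega>)" by (simp add: eventually_filtermap)
      moreover have "eventually (\<lambda>x. x \<in> S) (nhds l)" using S by (simp add: eventually_nhds_in_open)
      ultimately have "eventually (\<lambda>x. False) (inf (nhds l) (filtermap f \<omega>))"
        unfolding eventually_inf by blast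
      then show False using l by (simp add: trivial_limit_def)
    qed
  qed
  with tendsto_Lim[OF nb this] show ?thesis by simp
qed

context
  fixes \<omega> :: "nat filter" and scal :: "nat \<Rightarrow> real" and m :: "'a metric" and p :: 'a
  assumes \<omega>: "nonprincipal_ultrafilter \<omega>" and scal: "\<And>j. 0 < scal j" and p: "p \<in> mspace m"
begin

lemma seq_dist_tendsto:
  "((\<lambda>j. ennreal (mdist m (x j) (y j) / scal j)) \<longlongrightarrow> seq_dist \<omega> scal m x y) \<omega>"
  unfolding seq_dist_def by (rule ultrafilter_Lim[OF \<omega>])

lemma seq_dist_commute: "seq_dist \<omega> scal m x y = seq_dist \<omega> scal m y x"
  by (simp add: seq_dist_def mdist_commute)

lemma seq_dist_triangle:
  assumes "\<And>j. x j \<in> mspace m" "\<And>j. y j \<in> mspace m" "\<And>j. z j \<in> mspace m"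
  shows "seq_dist \<omega> scal m x z \<le> seq_dist \<omega> scal m x y + seq_dist \<omega> scal m y z"
proof (rule tendsto_le)
  show "\<omega> \<noteq> bot" using \<omega> by (simp add: nonprincipal_ultrafilter_def)
  show "((\<lambda>j. ennreal (mdist m (x j) (y j) / scal j) + ennreal (mdist m (y j) (z j) / scal j))
      \<longlongrightarrow> seq_dist \<omega> scal m x y + seq_dist \<omega> scal m y z) \<omega>"
    by (intro tendsto_add seq_dist_tendsto)
  show "((\<lambda>j. ennreal (mdist m (x j) (z j) / scal j)) \<longlongrightarrow> seq_dist \<omega> scal m x z) \<omega>"
    by (rule seq_dist_tendsto)
  have "ennreal (mdist m (x j) (z j) / scal j) \<le>
      ennreal (mdist m (x j) (y j) / scal j) + ennreal (mdist m (y j) (z j) / scal j)" for j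
    using mdist_triangle[OF assms(1,2,3), of j j j] scal[of j]
    by (simp add: ennreal_plus[symmetric] add_divide_distrib[symmetric] divide_right_mono
        ennreal_leI less_imp_le del: ennreal_plus)
  then show "\<forall>\<^sub>F j in \<omega>. ennreal (mdist m (x j) (z j) / scal j) \<le>
      ennreal (mdist m (x j) (y j) / scal j) + ennreal (mdist m (y j) (z j) / scal j)"
    by simp
qed

lemma seq_dist_refl:
  assumes "\<And>j. x j \<in> mspace m"
  shows "seq_dist \<omega> scal m x x = 0"
proof -
  have "\<omega> \<noteq> bot" using \<omega> by (simp add: nonprincipal_ultrafilter_def)
  moreover have "mdist m (x j) (x j) = 0" for j
    using assms[of j] mdist_zero[of "x j" m "x j"] by simp
  then have "(\<lambda>j. ennreal (mdist m (x j) (x j) / scal j)) = (\<lambda>j. 0)"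
    by simp
  ultimately show ?thesis
    using tendsto_Lim[OF _ tendsto_const, of \<omega> "0::ennreal"] by (simp add: seq_dist_def)
qed

lemma cone_seqsD:
  assumes "x \<in> cone_seqs \<omega> scal m p" shows "x j \<in> mspace m"
  using assms by (auto simp: cone_seqs_def)

lemma seq_dist_finite:
  assumes "x \<in> cone_seqs \<omega> scal m p" "y \<in> cone_seqs \<omega> scal m p"
  shows "seq_dist \<omega> scal m x y < \<infinity>"
proof -
  have "seq_dist \<omega> scal m x y \<le> seq_dist \<omega> scal m x (\<lambda>_. p) + seq_dist \<omega> scal m (\<lambda>_. p) y"
    using assms p by (intro seq_dist_triangle) (auto simp: cone_seqs_def)
  also have "\<dots> < \<infinity>"
    using assms by (simp add: cone_seqs_def seq_dist_commute[of _ y])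
  finally show ?thesis .
qed

lemma equiv_cone_rel: "equiv (cone_seqs \<omega> scal m p) (cone_rel \<omega> scal m p)"
proof (rule equivI)
  show "cone_rel \<omega> scal m p \<subseteq> cone_seqs \<omega> scal m p \<times> cone_seqs \<omega> scal m p"
    by (auto simp: cone_rel_def)
  show "refl_on (cone_seqs \<omega> scal m p) (cone_rel \<omega> scal m p)"
    by (auto simp: refl_on_def cone_rel_def seq_dist_refl cone_seqsD)
  show "sym (cone_rel \<omega> scal m p)"
    by (auto simp: sym_def cone_rel_def seq_dist_commute)
  show "trans (cone_rel \<omega> scal m p)"
  proof (rule transI)
    fix x y z assume *: "(x, y) \<in> cone_rel \<omega> scal m p" "(y, z) \<in> cone_rel \<omega> scal m p"
    then have "seq_dist \<omega> scal m x z \<le> seq_dist \<omega> scal m x y + seq_dist \<omega> scal m y z"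
      by (intro seq_dist_triangle) (auto simp: cone_rel_def cone_seqsD)
    with * show "(x, z) \<in> cone_rel \<omega> scal m p" by (auto simp: cone_rel_def)
  qed
qed

lemma seq_dist_cong:
  assumes "(x, x') \<in> cone_rel \<omega> scal m p" "(y, y') \<in> cone_rel \<omega> scal m p"
  shows "seq_dist \<omega> scal m x y = seq_dist \<omega> scal m x' y'"
proof -
  have le: "seq_dist \<omega> scal m u v \<le> seq_dist \<omega> scal m u' v'"
    if "(u, u') \<in> cone_rel \<omega> scal m p" "(v, v') \<in> cone_rel \<omega> scal m p" for u u' v v'
  proof -
    have "seq_dist \<omega> scal m u v \<le> seq_dist \<omega> scal m u u' + seq_dist \<omega> scal m u' v"
      using that by (intro seq_dist_triangle) (auto simp: cone_rel_def cone_seqsD)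
    also have "seq_dist \<omega> scal m u' v \<le> seq_dist \<omega> scal m u' v' + seq_dist \<omega> scal m v' v"
      using that by (intro seq_dist_triangle) (auto simp: cone_rel_def cone_seqsD)
    finally show ?thesis
      using that by (simp add: cone_rel_def seq_dist_commute[of v' v])
  qed
  have "(x', x) \<in> cone_rel \<omega> scal m p" "(y', y) \<in> cone_rel \<omega> scal m p"
    using assms equiv_cone_rel by (auto simp: equiv_def dest: symD)
  with le assms show ?thesis by (meson antisym)
qed

lemma seq_dist_some:
  assumes "x \<in> cone_seqs \<omega> scal m p" "y \<in> cone_seqs \<omega> scal m p"
  shows "seq_dist \<omega> scal m (SOME u. u \<in> cone_rel \<omega> scal m p `` {x})
           (SOME v. v \<in> cone_rel \<omega> scal m p `` {y}) = seq_dist \<omega> scal m x y"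
proof -
  have "(z, SOME u. u \<in> cone_rel \<omega> scal m p `` {z}) \<in> cone_rel \<omega> scal m p"
    if "z \<in> cone_seqs \<omega> scal m p" for z
    using someI[of "\<lambda>u. u \<in> cone_rel \<omega> scal m p `` {z}" z]
      equiv_class_self[OF equiv_cone_rel that] by simp
  with assms show ?thesis by (metis seq_dist_cong)
qed

lemma Metric_space_asymptotic_cone:
  "Metric_space (cone_seqs \<omega> scal m p // cone_rel \<omega> scal m p)
     (\<lambda>A B. enn2real (seq_dist \<omega> scal m (SOME x. x \<in> A) (SOME y. y \<in> B)))"
proof
  fix A B :: "(nat \<Rightarrow> 'a) set"
  show "0 \<le> enn2real (seq_dist \<omega> scal m (SOME x. x \<in> A) (SOME y. y \<in> B))" by simp
  show "enn2real (seq_dist \<omega> scal m (SOME x. x \<in> A) (SOME y. y \<in> B)) =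
        enn2real (seq_dist \<omega> scal m (SOME x. x \<in> B) (SOME y. y \<in> A))"
    by (simp add: seq_dist_commute)
next
  fix A B
  assume "A \<in> cone_seqs \<omega> scal m p // cone_rel \<omega> scal m p"
    and "B \<in> cone_seqs \<omega> scal m p // cone_rel \<omega> scal m p"
  then obtain x y where x: "x \<in> cone_seqs \<omega> scal m p" "A = cone_rel \<omega> scal m p `` {x}"
    and y: "y \<in> cone_seqs \<omega> scal m p" "B = cone_rel \<omega> scal m p `` {y}"
    by (auto elim!: quotientE)
  have "enn2real (seq_dist \<omega> scal m x y) = 0 \<longleftrightarrow> (x, y) \<in> cone_rel \<omega> scal m p"
    using seq_dist_finite[OF x(1) y(1)] x y by (auto simp: enn2real_eq_0_iff cone_rel_def)
  then show "(enn2real (seq_dist \<omega> scal m (SOME x. x \<in> A) (SOME y. y \<in> B)) = 0) = (A = B)"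
    using x y by (simp add: seq_dist_some eq_equiv_class_iff[OF equiv_cone_rel] del: Image_singleton_iff)
next
  fix A B C
  assume "A \<in> cone_seqs \<omega> scal m p // cone_rel \<omega> scal m p"
    and "B \<in> cone_seqs \<omega> scal m p // cone_rel \<omega> scal m p"
    and "C \<in> cone_seqs \<omega> scal m p // cone_rel \<omega> scal m p"
  then obtain x y z where x: "x \<in> cone_seqs \<omega> scal m p" "A = cone_rel \<omega> scal m p `` {x}"
    and y: "y \<in> cone_seqs \<omega> scal m p" "B = cone_rel \<omega> scal m p `` {y}"
    and z: "z \<in> cone_seqs \<omega> scal m p" "C = cone_rel \<omega> scal m p `` {z}"
    by (auto elim!: quotientE)
  have "seq_dist \<omega> scal m x z \<le> seq_dist \<omega> scal m x y + seq_dist \<omega> scal m y z"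
    using x y z by (intro seq_dist_triangle) (auto simp: cone_seqsD)
  then have "enn2real (seq_dist \<omega> scal m x z) \<le>
      enn2real (seq_dist \<omega> scal m x y + seq_dist \<omega> scal m y z)"
    using seq_dist_finite[OF x(1) y(1)] seq_dist_finite[OF y(1) z(1)]
    by (intro enn2real_mono) auto
  also have "\<dots> = enn2real (seq_dist \<omega> scal m x y) + enn2real (seq_dist \<omega> scal m y z)"
    using seq_dist_finite[OF x(1) y(1)] seq_dist_finite[OF y(1) z(1)]
    by (simp add: enn2real_plus)
  finally show "enn2real (seq_dist \<omega> scal m (SOME x. x \<in> A) (SOME y. y \<in> C)) \<le>
      enn2real (seq_dist \<omega> scal m (SOME x. x \<in> A) (SOME y. y \<in> B)) +
      enn2real (seq_dist \<omega> scal m (SOME x. x \<in> B) (SOME y. y \<in> C))"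
    using x y z by (simp add: seq_dist_some del: Image_singleton_iff)
qed

lemma mspace_asymptotic_cone:
  "mspace (asymptotic_cone \<omega> scal m p) = cone_seqs \<omega> scal m p // cone_rel \<omega> scal m p"
  by (simp add: asymptotic_cone_def Metric_space.mspace_metric[OF Metric_space_asymptotic_cone])

lemma mdist_asymptotic_cone:
  assumes "x \<in> cone_seqs \<omega> scal m p" "y \<in> cone_seqs \<omega> scal m p"
  shows "ennreal (mdist (asymptotic_cone \<omega> scal m p)
            (cone_rel \<omega> scal m p `` {x}) (cone_rel \<omega> scal m p `` {y})) = seq_dist \<omega> scal m x y"
  using seq_dist_finite[OF assms]
  by (simp add: asymptotic_cone_def Metric_space.mdist_metric[OF Metric_space_asymptotic_cone]
      seq_dist_some[OF assms] quotientI assms del: Image_singleton_iff)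

end

end

theory Submission
  imports Defs
begin

text \<open>
  Suppose that some flat \<open>\<eta>\<close> at bounded distance from \<open>\<phi>(\<gamma>)\<close> has a compact quotient; it is to be
  shown that every flat at bounded distance from \<open>\<phi>(\<gamma>)\<close> bounds a half-flat.  All such flats are at
  finite distance from \<open>\<eta>\<close>.

  A flat bounds a half-flat as soon as there are points \<open>q n\<close> going to infinity whose distance
  functions become constant on the flat in the limit (\<open>half_flat_of_far_points\<close>): the geodesics from the
  flat to \<open>q n\<close> converge to the half-flat, since closed balls are compact (\<open>Hopf_Rinow\<close>).  Such a
  sequence for one flat serves every flat at finite distance from it, because a bounded convex
  function on Euclidean space is constant (\<open>far_points_parallel\<close>).  As \<open>\<eta>\<close> is cocompact, it is enough
  to find, for all \<open>R\<close> and \<open>\<epsilon>\<close>, arbitrarily far points \<open>q\<close> whose distance to \<open>\<eta>\<close> is within \<open>\<epsilon>\<close> of its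
  minimum on some ball of radius \<open>R\<close> in \<open>\<eta>\<close>: translating the centres of these balls into a bounded
  region gives the sequence (\<open>far_points_of_cocompact\<close>).

  If such points did not exist, the nearest point projection to \<open>\<eta>\<close> would degenerate.  When \<open>q'\<close> is
  within \<open>s\<close> of \<open>q\<close>, and \<open>q\<close> is at distance \<open>D\<close> from \<open>\<eta>\<close>, the nearest point of \<open>q'\<close> has squared
  distance at most \<open>D\<^sup>2 + s\<^sup>2\<close> from \<open>q\<close> (\<open>proj_of_nearby\<close>), hence lies in the convex set of points of \<open>\<eta>\<close> at
  distance at most \<open>D + s\<^sup>2 / (2 * D)\<close> from \<open>q\<close>.  By convexity this set would contain only balls of
  radius \<open>O(s\<^sup>2 / D)\<close> (\<open>sublevel_shrink\<close>).  In the asymptotic cone, the points at height \<open>1\<close> in the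
  bi-Lipschitz half-flat stay at a definite distance from the limit flat, so projecting them gives
  a Lipschitz map of Euclidean space at bounded distance from the identity, for which the convex hull
  of the image of a ball of radius \<open>r\<close> contains only balls of radius \<open>O(r\<^sup>2)\<close>.  The image of such a
  map has volume zero, which contradicts its surjectivity (\<open>no_thin_map\<close>).

  The argument with the cone is carried out on sequences of points of the second space
  (\<open>half_flat_sequences\<close>, \<open>flat_sublevels\<close>).
\<close>

section \<open>Comparison inequalities in CAT(0) spaces\<close>

lemma stewart_identity:
  fixes x y z :: "'v::real_inner"
  shows "(dist z ((1 - s) *\<^sub>R x + s *\<^sub>R y))\<^sup>2
         = (1 - s) * (dist z x)\<^sup>2 + s * (dist z y)\<^sup>2 - s * (1 - s) * (dist x y)\<^sup>2"
proof -
  have n2: "(norm v)\<^sup>2 = v \<bullet> v" for v :: 'v by (rule power2_norm_eq_inner)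
  show ?thesis
    unfolding dist_norm n2
    by (simp add: inner_diff_left inner_diff_right inner_add_left inner_add_right inner_commute
        algebra_simps)
qed

lemma comparison_triangle_exists:
  fixes a b c :: real
  assumes "0 \<le> a" "0 \<le> b" "0 \<le> c" "a \<le> b + c" "b \<le> a + c" "c \<le> a + b"
  obtains p q r :: "real^2" where "dist p q = a" "dist q r = b" "dist r p = c"
proof (cases "a = 0")
  case True
  then have bc: "b = c" using assms by linarith
  let ?r = "vector [c, 0] :: real^2"
  have "dist ?r 0 = c" "dist 0 ?r = c"
    using assms by (simp_all add: dist_norm norm_vec_def L2_set_def UNIV_2 vector_2)
  with True bc show ?thesis using that[of 0 0 ?r] by simp
next
  case False
  define x where "x = (a\<^sup>2 + c\<^sup>2 - b\<^sup>2) / (2 * a)"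
  define y where "y = sqrt (c\<^sup>2 - x\<^sup>2)"
  have a: "a > 0" using False assms by simp
  have ax: "2 * a * x = a\<^sup>2 + c\<^sup>2 - b\<^sup>2" using a by (simp add: x_def)
  have "b\<^sup>2 \<le> (a + c)\<^sup>2" using assms by (intro power_mono) auto
  then have "2 * a * (x + c) \<ge> 0" using ax by (simp add: algebra_simps power2_eq_square)
  then have xc1: "x \<ge> -c" using a by (simp add: zero_le_mult_iff)
  have "(a - c)\<^sup>2 \<le> b\<^sup>2" using assms by (intro abs_le_square_iff[THEN iffD1]) auto
  then have "2 * a * (c - x) \<ge> 0" using ax by (simp add: algebra_simps power2_eq_square)
  then have xc2: "x \<le> c" using a by (simp add: zero_le_mult_iff)
  have "x\<^sup>2 \<le> c\<^sup>2" using xc1 xc2 assms by (intro abs_le_square_iff[THEN iffD1]) auto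
  then have y2: "y\<^sup>2 = c\<^sup>2 - x\<^sup>2" by (simp add: y_def)
  let ?p = "0 :: real^2" and ?q = "vector [a, 0] :: real^2" and ?r = "vector [x, y] :: real^2"
  have "dist ?p ?q = a"
    using a by (simp add: dist_norm norm_vec_def L2_set_def UNIV_2 vector_2)
  moreover have "dist ?r ?p = c"
    using assms y2 by (simp add: dist_norm norm_vec_def L2_set_def UNIV_2 vector_2)
  moreover have "dist ?q ?r = b"
  proof -
    have "(a - x)\<^sup>2 + y\<^sup>2 = b\<^sup>2" using y2 ax by (simp add: power2_eq_square algebra_simps)
    then show ?thesis
      using assms by (simp add: dist_norm norm_vec_def L2_set_def UNIV_2 vector_2)
  qed
  ultimately show ?thesis using that by blast
qed

locale cat0 =
  fixes M :: "'a metric"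
  assumes CAT0: "CAT0 M"
begin

abbreviation d :: "'a \<Rightarrow> 'a \<Rightarrow> real" where "d \<equiv> mdist M"
abbreviation X :: "'a set" where "X \<equiv> mspace M"

lemma d_refl: "x \<in> X \<Longrightarrow> d x x = 0" by simp

lemma d_reverse_triangle:
  assumes "x \<in> X" "y \<in> X" "z \<in> X"
  shows "\<bar>d x z - d y z\<bar> \<le> d x y"
  using mdist_triangle[OF assms] mdist_triangle[OF assms(2,1,3)] mdist_commute[of M x y] by linarith

lemma stewart_geodesic:
  assumes c: "isometric_embedding (submetric euclidean_metric {0..l}) M c" and l: "0 \<le> l"
    and s: "0 \<le> s" "s \<le> 1" and r: "r \<in> X"
  shows "(d r (c (s * l)))\<^sup>2 \<le> (1 - s) * (d r (c 0))\<^sup>2 + s * (d r (c l))\<^sup>2 - s * (1 - s) * l\<^sup>2"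
proof -
  have iso: "d (c x) (c y) = \<bar>x - y\<bar>" if "x \<in> {0..l}" "y \<in> {0..l}" for x y
    using c that by (simp add: isometric_embedding_def dist_real_def)
  have cX: "c x \<in> X" if "x \<in> {0..l}" for x
    using c that by (auto simp: isometric_embedding_def)
  define p q where "p = c 0" and "q = c l"
  have p: "p \<in> X" and q: "q \<in> X" using l by (auto simp: p_def q_def intro!: cX)
  have dpq: "d p q = l" using iso[of 0 l] l by (simp add: p_def q_def)
  have S1: "geodesic_segment M p q (c ` {0..l})"
    unfolding geodesic_segment_def using l c p_def q_def by blast
  obtain S2 where S2: "geodesic_segment M q r S2"
    using CAT0 q r unfolding CAT0_def by blast
  obtain S3 where S3: "geodesic_segment M r p S3"
    using CAT0 p r unfolding CAT0_def by blast
  have rS3: "r \<in> S3"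
    using S3 unfolding geodesic_segment_def by force
  obtain p' q' r' :: "real^2" where tri: "dist p' q' = d p q" "dist q' r' = d q r" "dist r' p' = d r p"
    using comparison_triangle_exists[of "d p q" "d q r" "d r p"]
      mdist_triangle[OF p r q] mdist_triangle[OF q p r] mdist_triangle[OF r q p]
      mdist_commute[of M p q] mdist_commute[of M q r] mdist_commute[of M r p]
    by (smt (verit) mdist_nonneg)
  define a' where "a' = (1 - s) *\<^sub>R p' + s *\<^sub>R q'"
  have sl: "s * l \<in> {0..l}"
    using s l by (simp add: mult_left_le_one_le)
  have "p' - a' = s *\<^sub>R (p' - q')" by (simp add: a'_def algebra_simps)
  then have "dist p' a' = s * l"
    using s tri(1) dpq by (simp add: dist_norm)
  moreover have "d p (c (s * l)) = s * l"
    using iso[of 0 "s * l"] sl l by (simp add: p_def)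
  ultimately have cmpa: "comparison_point M p (c ` {0..l}) p' q' (c (s * l)) a'"
    unfolding comparison_point_def using sl s
    by (auto simp: a'_def closed_segment_def)
  have cmpr: "comparison_point M r S3 r' p' r r'"
    unfolding comparison_point_def using rS3 r by simp
  have "d (c (s * l)) r \<le> dist a' r'"
    by (rule CAT0[unfolded CAT0_def Let_def, THEN conjunct2, rule_format, OF p q r S1 S2 S3 tri])
       (rule disjI1[OF cmpa], rule disjI2[OF disjI2[OF cmpr]])
  then have "(d r (c (s * l)))\<^sup>2 \<le> (dist r' a')\<^sup>2"
    by (intro power_mono) (simp_all add: mdist_commute dist_commute)
  also have "\<dots> = (1 - s) * (dist r' p')\<^sup>2 + s * (dist r' q')\<^sup>2 - s * (1 - s) * (dist p' q')\<^sup>2"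
    unfolding a'_def by (rule stewart_identity)
  finally show ?thesis
    using tri dpq by (simp add: p_def q_def mdist_commute dist_commute)
qed

definition seg :: "'a \<Rightarrow> 'a \<Rightarrow> real \<Rightarrow> 'a" where
  "seg p q = (SOME c. isometric_embedding (submetric euclidean_metric {0..d p q}) M c \<and>
                       c 0 = p \<and> c (d p q) = q)"

lemma seg:
  assumes p: "p \<in> X" and q: "q \<in> X"
  shows "isometric_embedding (submetric euclidean_metric {0..d p q}) M (seg p q)"
    and "seg p q 0 = p" and "seg p q (d p q) = q"
proof -
  obtain S where "geodesic_segment M p q S"
    using CAT0 p q unfolding CAT0_def by blast
  then obtain l :: real and c where l: "0 \<le> l"
    "isometric_embedding (submetric euclidean_metric {0..l}) M c" "c 0 = p" "c l = q"
    unfolding geodesic_segment_def by blast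
  have "d (c 0) (c l) = dist 0 l"
    using l(1,2) unfolding isometric_embedding_def by simp
  then have "d p q = l" using l(1) unfolding l(3,4) by (simp add: dist_real_def)
  with l have "\<exists>c. isometric_embedding (submetric euclidean_metric {0..d p q}) M c \<and>
                       c 0 = p \<and> c (d p q) = q" by metis
  from someI_ex[OF this, folded seg_def]
  show "isometric_embedding (submetric euclidean_metric {0..d p q}) M (seg p q)"
    and "seg p q 0 = p" and "seg p q (d p q) = q"
    by blast+
qed

lemma seg_in: "p \<in> X \<Longrightarrow> q \<in> X \<Longrightarrow> 0 \<le> t \<Longrightarrow> t \<le> d p q \<Longrightarrow> seg p q t \<in> X"
  using seg(1)[of p q] by (auto simp: isometric_embedding_def)

lemma seg_dist:
  assumes "p \<in> X" "q \<in> X" "0 \<le> t" "t \<le> d p q" "0 \<le> s" "s \<le> d p q"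
  shows "d (seg p q t) (seg p q s) = \<bar>t - s\<bar>"
  using seg(1)[of p q] assms by (simp add: isometric_embedding_def dist_real_def)

text \<open>A point dividing \<open>[p, q]\<close> in the ratio \<open>s : 1 - s\<close> is the point at that ratio on the
  chosen geodesic, by Stewart's inequality seen from the point itself; so the inequality holds
  without mentioning a geodesic.\<close>

lemma stewart:
  assumes "p \<in> X" "q \<in> X" "m \<in> X" "r \<in> X" "0 \<le> s" "s \<le> 1"
    and pm: "d p m = s * d p q" and mq: "d m q = (1 - s) * d p q"
  shows "(d r m)\<^sup>2 \<le> (1 - s) * (d r p)\<^sup>2 + s * (d r q)\<^sup>2 - s * (1 - s) * (d p q)\<^sup>2"
proof -
  let ?m = "seg p q (s * d p q)"
  have sl: "s * d p q \<le> d p q" using assms by (simp add: mult_left_le_one_le)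
  have mX: "?m \<in> X" using assms sl by (intro seg_in) auto
  have st: "(d z ?m)\<^sup>2 \<le> (1 - s) * (d z p)\<^sup>2 + s * (d z q)\<^sup>2 - s * (1 - s) * (d p q)\<^sup>2"
    if "z \<in> X" for z
    using stewart_geodesic[OF seg(1)[OF assms(1,2)], of s z] that assms seg(2,3)[OF assms(1,2)] by simp
  have "(d m ?m)\<^sup>2 \<le> (1 - s) * (s * d p q)\<^sup>2 + s * ((1 - s) * d p q)\<^sup>2 - s * (1 - s) * (d p q)\<^sup>2"
    using st[OF assms(3)] pm mq by (simp add: mdist_commute)
  also have "\<dots> = 0" by (simp add: power2_eq_square algebra_simps)
  finally have "m = ?m" using mX assms(3) by simp
  then show ?thesis using st[OF assms(4)] by simp
qed

lemma quadrilateral: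
  assumes "x1 \<in> X" "x2 \<in> X" "x3 \<in> X" "x4 \<in> X"
  shows "(d x1 x3)\<^sup>2 + (d x2 x4)\<^sup>2 \<le> (d x1 x2)\<^sup>2 + (d x2 x3)\<^sup>2 + (d x3 x4)\<^sup>2 + (d x4 x1)\<^sup>2"
proof -
  define m where "m = seg x1 x3 (d x1 x3 / 2)"
  have m: "m \<in> X" unfolding m_def using assms by (intro seg_in) auto
  have 1: "d x1 m = (1/2) * d x1 x3"
    using seg_dist[of x1 x3 0 "d x1 x3 / 2"] assms seg(2)[of x1 x3] by (simp add: m_def)
  have 2: "d m x3 = (1 - 1/2) * d x1 x3"
    using seg_dist[of x1 x3 "d x1 x3 / 2" "d x1 x3"] assms seg(3)[of x1 x3] by (simp add: m_def)
  have "(d x2 m)\<^sup>2 \<le> (1 - 1/2) * (d x2 x1)\<^sup>2 + 1/2 * (d x2 x3)\<^sup>2 - 1/2 * (1 - 1/2) * (d x1 x3)\<^sup>2"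
    by (rule stewart[OF assms(1,3) m assms(2) _ _ 1 2]) auto
  then have 3: "(d x2 m)\<^sup>2 \<le> (d x1 x2)\<^sup>2 / 2 + (d x2 x3)\<^sup>2 / 2 - (d x1 x3)\<^sup>2 / 4"
    by (simp add: mdist_commute)
  have "(d x4 m)\<^sup>2 \<le> (1 - 1/2) * (d x4 x1)\<^sup>2 + 1/2 * (d x4 x3)\<^sup>2 - 1/2 * (1 - 1/2) * (d x1 x3)\<^sup>2"
    by (rule stewart[OF assms(1,3) m assms(4) _ _ 1 2]) auto
  then have 4: "(d x4 m)\<^sup>2 \<le> (d x4 x1)\<^sup>2 / 2 + (d x3 x4)\<^sup>2 / 2 - (d x1 x3)\<^sup>2 / 4"
    by (simp add: mdist_commute)
  have 5: "(d x2 x4)\<^sup>2 \<le> (d x2 m + d x4 m)\<^sup>2"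
    using mdist_triangle[OF assms(2) m assms(4)] by (intro power_mono) (simp_all add: mdist_commute)
  have 6: "(d x2 m + d x4 m)\<^sup>2 \<le> 2 * (d x2 m)\<^sup>2 + 2 * (d x4 m)\<^sup>2"
    using zero_le_power2[of "d x2 m - d x4 m"] by (simp add: power2_eq_square algebra_simps)
  show ?thesis using 3 4 5 6 by linarith
qed

text \<open>The right-hand side is the squared distance of the points corresponding to \<open>seg x q t\<close> and
  \<open>seg y q s\<close> in the Euclidean triangle with side lengths \<open>d q x\<close>, \<open>d q y\<close>, \<open>d x y\<close>.\<close>

lemma triangle_comparison:
  assumes "q \<in> X" "x \<in> X" "y \<in> X" "0 \<le> t" "t \<le> d q x" "0 \<le> s" "s \<le> d q y" "0 < d q x" "0 < d q y"
  shows "(d (seg x q t) (seg y q s))\<^sup>2 \<le>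
     ((d q x - d q y) - (t - s))\<^sup>2
       - (1 - t / d q x) * (1 - s / d q y) * ((d q x - d q y)\<^sup>2 - (d x y)\<^sup>2)"
proof -
  define A B c where "A = d q x" and "B = d q y" and "c = d x y"
  define a b where "a = 1 - t / A" and "b = 1 - s / B"
  define u v where "u = seg x q t" and "v = seg y q s"
  have A: "0 < A" "t \<le> A" and B: "0 < B" "s \<le> B" using assms by (auto simp: A_def B_def)
  have com: "d x q = A" "d y q = B" by (simp_all add: A_def B_def mdist_commute)
  have a: "0 \<le> a" "a \<le> 1" and b: "0 \<le> b" "b \<le> 1"
    using A B assms by (simp_all add: a_def b_def)
  have aA: "a * A = A - t" and bB: "b * B = B - s"
    using A B by (simp_all add: a_def b_def field_simps)
  have u: "u \<in> X" "d x u = t" "d u q = A - t"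
    using seg_in[of x q t] seg_dist[of x q 0 t] seg_dist[of x q t "d x q"] seg(2,3)[of x q] assms A
    by (simp_all add: u_def com)
  have v: "v \<in> X" "d y v = s" "d v q = B - s"
    using seg_in[of y q s] seg_dist[of y q 0 s] seg_dist[of y q s "d y q"] seg(2,3)[of y q] assms B
    by (simp_all add: v_def com)
  have q1: "(d u v)\<^sup>2 \<le> (1 - b) * (d u q)\<^sup>2 + b * (d u y)\<^sup>2 - b * (1 - b) * (d q y)\<^sup>2"
  proof (rule stewart)
    show "d q v = b * d q y" using v bB by (simp add: mdist_commute B_def)
    show "d v y = (1 - b) * d q y" using v bB by (simp add: mdist_commute B_def algebra_simps)
  qed (use assms u v b in auto)
  have q2: "(d y u)\<^sup>2 \<le> (1 - a) * (d y q)\<^sup>2 + a * (d y x)\<^sup>2 - a * (1 - a) * (d q x)\<^sup>2"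
  proof (rule stewart)
    show "d q u = a * d q x" using u aA by (simp add: mdist_commute A_def)
    show "d u x = (1 - a) * d q x" using u aA by (simp add: mdist_commute A_def algebra_simps)
  qed (use assms u v a in auto)
  have "(d u v)\<^sup>2 \<le> (1 - b) * (a * A)\<^sup>2 + b * (d u y)\<^sup>2 - b * (1 - b) * B\<^sup>2"
    using q1 u aA by (simp add: B_def)
  also have "\<dots> \<le> (1 - b) * (a * A)\<^sup>2 + b * ((1 - a) * B\<^sup>2 + a * c\<^sup>2 - a * (1 - a) * A\<^sup>2)
                  - b * (1 - b) * B\<^sup>2"
    using mult_left_mono[OF q2 b(1)] com by (simp add: mdist_commute A_def c_def)
  also have "\<dots> = ((a * A) - (b * B))\<^sup>2 - a * b * ((A - B)\<^sup>2 - c\<^sup>2)"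
    by (simp add: power2_eq_square algebra_simps)
  also have "\<dots> = ((A - B) - (t - s))\<^sup>2 - a * b * ((A - B)\<^sup>2 - c\<^sup>2)"
    unfolding aA bB by (simp add: algebra_simps)
  finally show ?thesis by (simp add: u_def v_def A_def B_def c_def a_def b_def)
qed

end

section \<open>Nearest points on a flat\<close>

locale flat_in_cat0 = cat0 M for M :: "'a metric" +
  fixes e :: "real^'k::finite \<Rightarrow> 'a"
  assumes e: "isometric_embedding euclidean_metric M e"
begin

lemma e_in [simp]: "e x \<in> X"
  using e by (auto simp: isometric_embedding_def)

lemma e_dist [simp]: "d (e x) (e y) = dist x y"
  using e by (simp add: isometric_embedding_def)

lemma flat_stewart:
  assumes q: "q \<in> X" and s: "0 \<le> s" "s \<le> 1"
  shows "(d q (e ((1 - s) *\<^sub>R x + s *\<^sub>R y)))\<^sup>2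
          \<le> (1 - s) * (d q (e x))\<^sup>2 + s * (d q (e y))\<^sup>2 - s * (1 - s) * (dist x y)\<^sup>2"
proof -
  let ?m = "(1 - s) *\<^sub>R x + s *\<^sub>R y"
  have "x - ?m = s *\<^sub>R (x - y)" "?m - y = (1 - s) *\<^sub>R (x - y)" by (simp_all add: algebra_simps)
  then have "dist x ?m = s * dist x y" "dist ?m y = (1 - s) * dist x y"
    using s by (simp_all add: dist_norm)
  then show ?thesis
    using stewart[of "e x" "e y" "e ?m" q s] q s by simp
qed

lemma flat_lipschitz: "q \<in> X \<Longrightarrow> \<bar>d q (e x) - d q (e y)\<bar> \<le> dist x y"
  using d_reverse_triangle[of "e x" "e y" q] by (simp add: mdist_commute)

lemma flat_convex:
  assumes q: "q \<in> X" and s: "0 \<le> s" "s \<le> 1"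
  shows "d q (e ((1 - s) *\<^sub>R x + s *\<^sub>R y)) \<le> (1 - s) * d q (e x) + s * d q (e y)"
proof -
  have "(d q (e x) - d q (e y))\<^sup>2 \<le> (dist x y)\<^sup>2"
    using flat_lipschitz[OF q, of x y] by (intro abs_le_square_iff[THEN iffD1]) simp
  then have "s * (1 - s) * (d q (e x) - d q (e y))\<^sup>2 \<le> s * (1 - s) * (dist x y)\<^sup>2"
    using s by (intro mult_left_mono) auto
  then have "(d q (e ((1 - s) *\<^sub>R x + s *\<^sub>R y)))\<^sup>2 \<le>
     (1 - s) * (d q (e x))\<^sup>2 + s * (d q (e y))\<^sup>2 - s * (1 - s) * (d q (e x) - d q (e y))\<^sup>2"
    using flat_stewart[OF q s, of x y] by linarith
  also have "\<dots> = ((1 - s) * d q (e x) + s * d q (e y))\<^sup>2"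
    by (simp add: power2_eq_square algebra_simps)
  finally show ?thesis
    using s by (auto intro: power2_le_imp_le)
qed

lemma flat_continuous:
  assumes q: "q \<in> X" shows "continuous_on S (\<lambda>x. d q (e x))"
proof (rule continuous_onI)
  fix x \<epsilon> :: real and y assume "0 < \<epsilon>"
  then show "\<exists>\<delta>>0. \<forall>x'\<in>S. dist x' y < \<delta> \<longrightarrow> dist (d q (e x')) (d q (e y)) \<le> \<epsilon>"
    using flat_lipschitz[OF q] by (intro exI[of _ \<epsilon>]) (auto simp: dist_real_def intro: order_trans[OF _ less_imp_le])
qed

definition proj :: "'a \<Rightarrow> real^'k" where
  "proj q = (SOME w. \<forall>x. d q (e w) \<le> d q (e x))"

lemma proj_le:
  assumes q: "q \<in> X" shows "d q (e (proj q)) \<le> d q (e x)"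
proof -
  let ?r = "2 * d q (e 0)"
  obtain w where w: "\<forall>x\<in>cball 0 ?r. d q (e w) \<le> d q (e x)"
    using continuous_attains_inf[OF _ _ flat_continuous[OF q], of "cball 0 ?r"]
    by (metis cball_eq_empty compact_cball mdist_nonneg mult_nonneg_nonneg not_less zero_le_numeral)
  have "d q (e w) \<le> d q (e x)" for x
  proof (cases "x \<in> cball 0 ?r")
    case False
    then have "?r < d (e 0) (e x)" by simp
    also have "\<dots> \<le> d q (e 0) + d q (e x)"
      using mdist_triangle[of "e 0" M q "e x"] q by (simp add: mdist_commute)
    finally show ?thesis using bspec[OF w, of 0] by simp
  qed (use w in blast)
  then have "\<exists>w. \<forall>x. d q (e w) \<le> d q (e x)" by blast
  from someI_ex[OF this] show ?thesis unfolding proj_def by blast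
qed

lemma proj_right_angle:
  assumes q: "q \<in> X"
  shows "(d q (e (proj q)))\<^sup>2 + (dist (proj q) x)\<^sup>2 \<le> (d q (e x))\<^sup>2"
proof -
  define D l B where "D = d q (e (proj q))" and "l = dist (proj q) x" and "B = d q (e x)"
  \<comment> \<open>Minimality of the distance along the segment from \<open>proj q\<close> to \<open>x\<close>, to first order.\<close>
  have *: "D\<^sup>2 + l\<^sup>2 \<le> B\<^sup>2 + s * l\<^sup>2" if s: "0 < s" "s \<le> 1" for s
  proof -
    have "D\<^sup>2 \<le> (d q (e ((1 - s) *\<^sub>R proj q + s *\<^sub>R x)))\<^sup>2"
      unfolding D_def using proj_le[OF q] by (intro power_mono) auto
    also have "\<dots> \<le> (1 - s) * D\<^sup>2 + s * B\<^sup>2 - s * (1 - s) * l\<^sup>2"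
      unfolding D_def l_def B_def using flat_stewart[OF q, of s] s by simp
    finally have "s * (D\<^sup>2 + l\<^sup>2) \<le> s * (B\<^sup>2 + s * l\<^sup>2)"
      by (simp add: algebra_simps)
    then show ?thesis using s by simp
  qed
  have "D\<^sup>2 + l\<^sup>2 \<le> B\<^sup>2"
  proof (rule field_le_epsilon)
    fix \<epsilon> :: real assume \<epsilon>: "0 < \<epsilon>"
    define s where "s = min 1 (\<epsilon> / (l\<^sup>2 + 1))"
    have p: "0 < l\<^sup>2 + 1" by (simp add: add_nonneg_pos)
    have s: "0 < s" "s \<le> 1" using \<epsilon> p by (simp_all add: s_def)
    have "s * l\<^sup>2 \<le> \<epsilon> / (l\<^sup>2 + 1) * (l\<^sup>2 + 1)"
      using \<epsilon> p by (intro mult_mono) (auto simp: s_def)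
    also have "\<dots> = \<epsilon>" using p by simp
    finally show "D\<^sup>2 + l\<^sup>2 \<le> B\<^sup>2 + \<epsilon>" using *[OF s] by linarith
  qed
  then show ?thesis by (simp add: D_def l_def B_def)
qed

text \<open>In the quadrilateral formed by \<open>q\<close>, \<open>q'\<close> and their nearest points, the diagonal from
  \<open>q'\<close> is long because of the right angle at \<open>proj q'\<close>, so the other diagonal is short.  The
  error is quadratic in \<open>d q q'\<close>; the whole argument lives on this gain.\<close>

lemma proj_of_nearby:
  assumes q: "q \<in> X" and q': "q' \<in> X"
  shows "(d q (e (proj q')))\<^sup>2 \<le> (d q (e (proj q)))\<^sup>2 + (d q q')\<^sup>2"
proof -
  have "(d q (e (proj q')))\<^sup>2 + (d q' (e (proj q)))\<^sup>2 \<le>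
    (d q q')\<^sup>2 + (d q' (e (proj q')))\<^sup>2 + (dist (proj q') (proj q))\<^sup>2 + (d q (e (proj q)))\<^sup>2"
    using quadrilateral[of q q' "e (proj q')" "e (proj q)"] q q'
    by (simp add: mdist_commute[of M "e (proj q)" q] mdist_commute[of M "e (proj q')" q'])
  moreover have "(d q' (e (proj q')))\<^sup>2 + (dist (proj q') (proj q))\<^sup>2 \<le> (d q' (e (proj q)))\<^sup>2"
    by (rule proj_right_angle[OF q'])
  ultimately show ?thesis by linarith
qed

lemma proj_lipschitz:
  assumes q: "q \<in> X" and q': "q' \<in> X"
  shows "dist (proj q) (proj q') \<le> d q q'"
proof -
  have "(dist (proj q) (proj q'))\<^sup>2 \<le> (d q q')\<^sup>2"
    using proj_of_nearby[OF q q'] proj_right_angle[OF q, of "proj q'"] by linarith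
  then show ?thesis by (rule power2_le_imp_le) simp
qed

end

section \<open>Compactness\<close>

text \<open>The radii \<open>r\<close> for which the closed ball is compact form a set that is open, by local
  compactness, and closed, because the ball of radius \<open>r\<close> is within \<open>r - s\<close> of the ball of
  radius \<open>s < r\<close>; both steps move points along geodesics towards the centre.\<close>

theorem (in cat0) Hopf_Rinow:
  assumes cpl: "mcomplete_of M" and lc: "locally_compact_space (mtopology_of M)" and a: "a \<in> X"
  shows "compactin (mtopology_of M) (mcball_of M a r)"
proof -
  interpret MS: Metric_space "mspace M" "mdist M" by simp
  have mt: "mtopology_of M = MS.mtopology" and mb: "mcball_of M = MS.mcball"
    by (auto simp: mtopology_of_def mcball_of_def)
  have cpl': "MS.mcomplete" using cpl by (simp add: mcomplete_of_def)
  have toward: "\<exists>y\<in>X. d a y \<le> s \<and> d y x \<le> r - s"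
    if "x \<in> X" "d a x \<le> r" "0 \<le> s" "s \<le> r" for x r s
  proof (cases "d a x \<le> s")
    case True then show ?thesis using that by (intro bexI[of _ x]) auto
  next
    case False
    then show ?thesis
      using that seg_in[of a x s] seg_dist[of a x 0 s] seg_dist[of a x s "d a x"] seg(2,3)[of a x] a
      by (intro bexI[of _ "seg a x s"]) auto
  qed
  define C where "C r \<longleftrightarrow> compactin MS.mtopology (MS.mcball a r)" for r
  have down: "C s" if "C r" "s \<le> r" for r s
    using closed_compactin[of MS.mtopology "MS.mcball a r" "MS.mcball a s"]
      MS.mcball_subset_concentric[of s r] that by (simp add: C_def)
  have C0: "C s" if "s \<le> 0" for s
  proof -
    have "x = a" if x: "x \<in> MS.mcball a s" for x
    proof -
      have "d a x \<le> 0" using x \<open>s \<le> 0\<close> by auto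
      then have "d a x = 0" by (simp add: order_antisym)
      then show ?thesis using x by auto
    qed
    then have "MS.mcball a s \<subseteq> {a}" by blast
    then have "finite (MS.mcball a s)" by (rule finite_subset) simp
    then show ?thesis unfolding C_def
      by (intro finite_imp_compactin) (auto simp: MS.mcball_subset_mspace)
  qed
  have op: "\<exists>\<epsilon>>0. C (r + \<epsilon>)" if Cr: "C r" and r0: "0 \<le> r" for r
  proof -
    obtain U L where UL: "openin MS.mtopology U" "compactin MS.mtopology L"
       "MS.mcball a r \<subseteq> U" "U \<subseteq> L"
      using lc[unfolded mt] Cr[unfolded C_def] MS.Hausdorff_space_mtopology
        locally_compact_space_compact_closed_compact[of MS.mtopology] by meson
    obtain \<epsilon> where \<epsilon>: "\<epsilon> > 0" "\<And>x. x \<in> MS.mcball a r \<Longrightarrow> MS.mball x \<epsilon> \<subseteq> U"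
      using MS.lebesgue_number[of "MS.mcball a r" "{U}"] Cr UL by (auto simp: C_def)
    have "MS.mcball a (r + \<epsilon>/2) \<subseteq> L"
    proof
      fix x assume "x \<in> MS.mcball a (r + \<epsilon>/2)"
      then have x: "x \<in> X" "d a x \<le> r + \<epsilon>/2" by auto
      then obtain y where y: "y \<in> X" "d a y \<le> r" "d y x \<le> r + \<epsilon>/2 - r"
        using toward[of x "r + \<epsilon>/2" r] r0 \<epsilon>(1) by auto
      then have "x \<in> MS.mball y \<epsilon>" using x \<epsilon>(1) by simp
      then show "x \<in> L" using \<epsilon>(2)[of y] y a UL(4) by auto
    qed
    then have "C (r + \<epsilon>/2)"
      unfolding C_def using UL(2) by (intro closed_compactin[OF UL(2)]) auto
    then show ?thesis using \<epsilon>(1) by (intro exI[of _ "\<epsilon>/2"]) simp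
  qed
  have cl: "C r" if lt: "\<And>s. s < r \<Longrightarrow> C s" and r: "0 < r" for r
  proof -
    have "MS.mtotally_bounded (MS.mcball a r)"
      unfolding MS.mtotally_bounded_def
    proof (intro allI impI)
      fix \<epsilon> :: real assume \<epsilon>: "0 < \<epsilon>"
      define s where "s = max 0 (r - \<epsilon>/2)"
      have s: "0 \<le> s" "s < r" "r - s \<le> \<epsilon>/2" unfolding s_def using r \<epsilon> by linarith+
      have "MS.mtotally_bounded (MS.mcball a s)"
        using lt[OF s(2)] MS.compactin_imp_mtotally_bounded by (simp add: C_def)
      then obtain K where K: "finite K" "K \<subseteq> MS.mcball a s" "MS.mcball a s \<subseteq> (\<Union>x\<in>K. MS.mball x (\<epsilon>/2))"
        using \<epsilon> unfolding MS.mtotally_bounded_def by (meson half_gt_zero)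
      show "\<exists>K. finite K \<and> K \<subseteq> MS.mcball a r \<and> MS.mcball a r \<subseteq> (\<Union>x\<in>K. MS.mball x \<epsilon>)"
      proof (intro exI conjI)
        show "K \<subseteq> MS.mcball a r"
          using K(2) MS.mcball_subset_concentric[of s r a] s by auto
        show "MS.mcball a r \<subseteq> (\<Union>x\<in>K. MS.mball x \<epsilon>)"
        proof
          fix x assume "x \<in> MS.mcball a r"
          then have x: "x \<in> X" "d a x \<le> r" by auto
          then obtain y where y: "y \<in> X" "d a y \<le> s" "d y x \<le> r - s"
            using toward[of x r s] s by auto
          then obtain z where z: "z \<in> K" "z \<in> X" "d z y < \<epsilon>/2" using K(3) a by auto
          then have "d z x < \<epsilon>" using mdist_triangle[of z M y x] x y s by auto
          then show "x \<in> (\<Union>x\<in>K. MS.mball x \<epsilon>)" using z x by auto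
        qed
      qed (rule K(1))
    qed
    then have "compactin MS.mtopology (MS.mtopology closure_of MS.mcball a r)"
      using MS.mtotally_bounded_eq_compact_closure_of[OF cpl'] by blast
    then show ?thesis by (simp add: C_def closure_of_closedin)
  qed
  have "C r"
  proof (rule ccontr)
    assume nr: "\<not> C r"
    define S where "S = {s. C s}"
    have bdd: "bdd_above S"
      using down nr by (intro bdd_aboveI[of _ r]) (metis S_def mem_Collect_eq linorder_le_cases)
    have S0: "0 \<in> S" using C0[of 0] by (simp add: S_def)
    have sup0: "0 \<le> Sup S" using cSup_upper[OF S0 bdd] .
    have below: "C s" if "s < Sup S" for s
    proof -
      obtain t where "t \<in> S" "s < t" using less_cSup_iff[of S s] \<open>s < Sup S\<close> S0 bdd by blast
      then show ?thesis using down[of t s] by (simp add: S_def)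
    qed
    have "C (Sup S)"
      using cl[OF below] C0[of "Sup S"] by (cases "Sup S \<le> 0") auto
    then obtain \<epsilon> where "\<epsilon> > 0" "C (Sup S + \<epsilon>)" using op sup0 by blast
    then show False using cSup_upper[of "Sup S + \<epsilon>" S] bdd by (simp add: S_def)
  qed
  then show ?thesis by (simp add: C_def mt mb)
qed

definition ultrafilter :: "'i filter \<Rightarrow> bool" where
  "ultrafilter \<omega> \<longleftrightarrow> \<omega> \<noteq> bot \<and> (\<forall>P. eventually P \<omega> \<or> eventually (\<lambda>i. \<not> P i) \<omega>)"

lemma ultra_limit_in_compact:
  assumes \<omega>: "ultrafilter \<omega>" and K: "compactin T K" and f: "eventually (\<lambda>i. f i \<in> K) \<omega>"
  shows "\<exists>l\<in>K. limitin T f l \<omega>"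
proof (rule ccontr)
  assume no: "\<not> ?thesis"
  have "\<exists>U. openin T U \<and> l \<in> U \<and> eventually (\<lambda>i. f i \<notin> U) \<omega>" if "l \<in> K" for l
  proof -
    have "\<not> limitin T f l \<omega>" using no \<open>l \<in> K\<close> by blast
    then obtain U where "openin T U" "l \<in> U" "\<not> eventually (\<lambda>i. f i \<in> U) \<omega>"
      using \<open>l \<in> K\<close> compactin_subset_topspace[OF K] by (auto simp: limitin_def)
    then show ?thesis using \<omega> unfolding ultrafilter_def by blast
  qed
  then obtain U where U: "\<And>l. l \<in> K \<Longrightarrow> openin T (U l) \<and> l \<in> U l \<and> eventually (\<lambda>i. f i \<notin> U l) \<omega>"
    by metis
  have "Ball (U ` K) (openin T)" "K \<subseteq> \<Union>(U ` K)" using U by auto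
  then obtain F where F: "finite F" "F \<subseteq> U ` K" "K \<subseteq> \<Union>F"
    using K unfolding compactin_def by (metis (no_types))
  have "eventually (\<lambda>i. \<forall>V\<in>F. f i \<notin> V) \<omega>"
    using F(1,2) U by (intro eventually_ball_finite) auto
  with f have "eventually (\<lambda>i. False) \<omega>"
    by eventually_elim (use F(3) in auto)
  then show False using \<omega> by (simp add: ultrafilter_def trivial_limit_def)
qed

lemma ultra_limit_bounded:
  fixes f :: "'i \<Rightarrow> 'v::euclidean_space"
  assumes \<omega>: "ultrafilter \<omega>" and f: "eventually (\<lambda>i. norm (f i) \<le> B) \<omega>"
  shows "\<exists>l. (f \<longlongrightarrow> l) \<omega>"
  using ultra_limit_in_compact[OF \<omega>, of euclidean "cball 0 B" f] f
  by (auto simp: limitin_canonical_iff)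

context cat0 begin

lemma limitin_mdist:
  assumes "limitin (mtopology_of M) f l \<omega>" "limitin (mtopology_of M) g m \<omega>"
  shows "((\<lambda>n. d (f n) (g n)) \<longlongrightarrow> d l m) \<omega>"
proof (rule tendstoI)
  interpret MS: Metric_space "mspace M" "mdist M" by simp
  fix \<epsilon> :: real assume "0 < \<epsilon>"
  then have "\<epsilon>/2 > 0" by simp
  then have "eventually (\<lambda>n. f n \<in> X \<and> d (f n) l < \<epsilon>/2) \<omega>" "eventually (\<lambda>n. g n \<in> X \<and> d (g n) m < \<epsilon>/2) \<omega>"
    and lm: "l \<in> X" "m \<in> X"
    using assms unfolding mtopology_of_def MS.limitin_metric by blast+
  from this(1,2) show "eventually (\<lambda>n. dist (d (f n) (g n)) (d l m) < \<epsilon>) \<omega>"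
  proof eventually_elim
    case (elim n)
    then show ?case
      using d_reverse_triangle[of "f n" l "g n"] d_reverse_triangle[of "g n" m l] lm
      by (auto simp: dist_real_def mdist_commute[of M l "g n"] mdist_commute[of M l m])
  qed
qed

end

section \<open>Half-flats from far away points\<close>

context flat_in_cat0 begin

text \<open>The half-flat is swept out by the limits of the geodesics from the points of the flat to
  \<open>q n\<close>.  Comparison triangles bound distances in the limit from above by the Euclidean ones.
  Two points at the same height are also no closer, since otherwise two far away points of the
  flat would be joined by a shortcut.  For different heights, \<open>(d A (H y s))\<^sup>2 - s\<^sup>2\<close> is a convex
  function of \<open>s\<close> which touches its affine upper bound at the height of \<open>A\<close>, hence agrees with it.\<close>

theorem half_flat_of_far_points:
  assumes \<omega>: "ultrafilter \<omega>"
    and proper: "\<And>r. compactin (mtopology_of M) (mcball_of M (e 0) r)"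
    and q: "\<And>n. q n \<in> X"
    and far: "filterlim (\<lambda>n. d (q n) (e 0)) at_top \<omega>"
    and equi: "\<And>x. ((\<lambda>n. d (q n) (e x) - d (q n) (e 0)) \<longlongrightarrow> 0) \<omega>"
  shows "bounds_half_flat TYPE('k) M (range e)"
proof -
  have nb: "\<omega> \<noteq> bot" using \<omega> by (simp add: ultrafilter_def)
  define D where "D x n = d (q n) (e x)" for x n
  define Hn where "Hn x t n = (if 0 \<le> t \<and> t \<le> D x n then seg (e x) (q n) t else e x)" for x t n
  have farx: "filterlim (D x) at_top \<omega>" for x
  proof -
    have "filterlim (\<lambda>n. (d (q n) (e x) - d (q n) (e 0)) + d (q n) (e 0)) at_top \<omega>"
      by (rule filterlim_tendsto_add_at_top[OF equi far])
    then show ?thesis by (simp add: D_def[abs_def])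
  qed
  have ev: "eventually (\<lambda>n. t < D x n) \<omega>" for x t
    using farx[of x] by (auto simp: filterlim_at_top_dense)
  have dD: "d (e x) (q n) = D x n" for x n by (simp add: D_def mdist_commute)
  have HnX: "Hn x t n \<in> X" for x t n
    using seg_in[of "e x" "q n" t] q by (auto simp: Hn_def dD)
  have ray: "eventually (\<lambda>n. d (Hn x t n) (Hn x s n) = \<bar>t - s\<bar>) \<omega>" if "0 \<le> t" "0 \<le> s" for x t s
    using ev[of t x] ev[of s x]
  proof eventually_elim
    case (elim n)
    then show ?case using seg_dist[of "e x" "q n" t s] q that by (simp add: Hn_def dD)
  qed
  have Hn0: "Hn x 0 n = e x" for x n using seg(2)[of "e x" "q n"] q by (simp add: Hn_def)
  have "\<exists>l\<in>X. limitin (mtopology_of M) (Hn x t) l \<omega>" if t: "0 \<le> t" for x t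
  proof -
    have "eventually (\<lambda>n. Hn x t n \<in> mcball_of M (e 0) (norm x + t)) \<omega>"
      using ray[OF t order_refl, of x]
    proof eventually_elim
      case (elim n)
      then show ?case
        using mdist_triangle[of "e 0" M "e x" "Hn x t n"] t HnX Hn0
        by (simp add: mdist_commute[of M "Hn x t n"])
    qed
    then obtain l where "l \<in> mcball_of M (e 0) (norm x + t)" "limitin (mtopology_of M) (Hn x t) l \<omega>"
      using ultra_limit_in_compact[OF \<omega> proper] by blast
    then show ?thesis by auto
  qed
  then have "\<forall>x t. \<exists>l. 0 \<le> t \<longrightarrow> l \<in> X \<and> limitin (mtopology_of M) (Hn x t) l \<omega>" by blast
  then obtain H where HX: "\<And>x t. 0 \<le> t \<Longrightarrow> H x t \<in> X"
    and Hlim: "\<And>x t. 0 \<le> t \<Longrightarrow> limitin (mtopology_of M) (Hn x t) (H x t) \<omega>"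
    by (subst (asm) choice_iff, subst (asm) choice_iff) blast
  have Hd: "((\<lambda>n. d (Hn x t n) (Hn y s n)) \<longlongrightarrow> d (H x t) (H y s)) \<omega>" if "0 \<le> t" "0 \<le> s" for x t y s
    by (rule limitin_mdist[OF Hlim[OF that(1)] Hlim[OF that(2)]])
  have Hray: "d (H x t) (H x s) = \<bar>t - s\<bar>" if "0 \<le> t" "0 \<le> s" for x t s
    using tendsto_unique[OF nb Hd[OF that, of x x]] tendsto_eventually[OF ray[OF that, of x]] by blast
  have H0: "H x 0 = e x" for x
  proof -
    have "limitin (mtopology_of M) (Hn x 0) (e x) \<omega>"
      by (intro limitin_eventually) (auto simp: Hn0)
    then have "((\<lambda>n. d (Hn x 0 n) (Hn x 0 n)) \<longlongrightarrow> d (H x 0) (e x)) \<omega>"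
      by (rule limitin_mdist[OF Hlim[OF order_refl]])
    moreover have "(\<lambda>n. d (Hn x 0 n) (Hn x 0 n)) = (\<lambda>n. 0)"
      by (rule ext) (rule d_refl[OF HnX])
    ultimately have "d (H x 0) (e x) = 0"
      using tendsto_unique[OF nb _ tendsto_const] by metis
    then show ?thesis using HX by simp
  qed
  have upper: "(d (H x t) (H y s))\<^sup>2 \<le> (t - s)\<^sup>2 + (dist x y)\<^sup>2" if ts: "0 \<le> t" "0 \<le> s" for x t y s
  proof -
    let ?b = "\<lambda>n. ((D x n - D y n) - (t - s))\<^sup>2
       - (1 - t / D x n) * (1 - s / D y n) * ((D x n - D y n)\<^sup>2 - (dist x y)\<^sup>2)"
    have "eventually (\<lambda>n. (d (Hn x t n) (Hn y s n))\<^sup>2 \<le> ?b n) \<omega>"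
      using ev[of t x] ev[of s y]
    proof eventually_elim
      case (elim n)
      then show ?case
        using triangle_comparison[of "q n" "e x" "e y" t s] q ts by (simp add: Hn_def D_def)
    qed
    moreover have "((\<lambda>n. (d (Hn x t n) (Hn y s n))\<^sup>2) \<longlongrightarrow> (d (H x t) (H y s))\<^sup>2) \<omega>"
      by (intro tendsto_intros Hd ts)
    moreover have diff: "((\<lambda>n. D x n - D y n) \<longlongrightarrow> 0) \<omega>"
      using tendsto_diff[OF equi[of x] equi[of y]] by (simp add: D_def)
    have "(?b \<longlongrightarrow> (0 - (t - s))\<^sup>2 - (1 - 0) * (1 - 0) * (0\<^sup>2 - (dist x y)\<^sup>2)) \<omega>"
      by (intro tendsto_intros diff real_tendsto_divide_at_top[OF tendsto_const] farx)
    ultimately have "(d (H x t) (H y s))\<^sup>2 \<le> (0 - (t - s))\<^sup>2 - (1 - 0) * (1 - 0) * (0\<^sup>2 - (dist x y)\<^sup>2)"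
      using tendsto_le[OF nb] by blast
    then show ?thesis by (simp add: power2_commute)
  qed
  have level: "dist x y \<le> d (H x t) (H y t)" if t: "0 \<le> t" for x y t
  proof (cases "x = y")
    case False
    define v where "v = (y - x) /\<^sub>R norm (y - x)"
    have v: "norm v = 1" "norm (y - x) *\<^sub>R v = y - x" using False by (simp_all add: v_def)
    \<comment> \<open>Two points of the flat on the line through \<open>x\<close> and \<open>y\<close>, at distance \<open>N\<close> beyond them.\<close>
    have *: "dist x y \<le> d (H x t) (H y t) + t\<^sup>2 / N" if N: "0 < N" for N
    proof -
      define x' y' where "x' = x - N *\<^sub>R v" and "y' = y + N *\<^sub>R v"
      have "y' - x' = (2 * N + norm (y - x)) *\<^sub>R v"
        unfolding scaleR_add_left v(2) by (simp add: x'_def y'_def algebra_simps flip: scaleR_2)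
      then have far': "dist y' x' = 2 * N + dist x y"
        using N v(1) by (simp add: dist_norm norm_minus_commute)
      have near: "dist x' x = N" "dist y' y = N"
        using N v(1) by (simp_all add: x'_def y'_def dist_norm)
      have up: "d (e w) (H z t) \<le> N + t\<^sup>2 / (2 * N)" if "dist w z = N" for w z
      proof -
        have "(d (e w) (H z t))\<^sup>2 \<le> t\<^sup>2 + N\<^sup>2"
          using upper[of 0 t w z] t that by (simp add: H0)
        also have "\<dots> \<le> (N + t\<^sup>2 / (2 * N))\<^sup>2"
          using N t by (simp add: power2_eq_square field_simps)
        finally show ?thesis using N by (auto intro: power2_le_imp_le)
      qed
      have "d (e y') (e x') \<le> d (e y') (H y t) + d (H y t) (H x t) + d (H x t) (e x')"
        using mdist_triangle[of "e y'" M "H y t" "e x'"] mdist_triangle[of "H y t" M "H x t" "e x'"] HX t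
        by simp
      also have "\<dots> \<le> (N + t\<^sup>2 / (2 * N)) + d (H x t) (H y t) + (N + t\<^sup>2 / (2 * N))"
        using up[OF near(1)] up[OF near(2)] by (simp add: mdist_commute)
      finally show ?thesis using far' by (simp add: field_simps)
    qed
    show ?thesis
    proof (rule field_le_epsilon)
      fix \<epsilon> :: real assume \<epsilon>: "0 < \<epsilon>"
      have N: "0 < t\<^sup>2 / \<epsilon> + 1" using \<epsilon> by (simp add: add_nonneg_pos)
      have "t\<^sup>2 / (t\<^sup>2 / \<epsilon> + 1) \<le> \<epsilon>"
        using \<epsilon> N by (simp add: divide_le_eq algebra_simps)
      then show "dist x y \<le> d (H x t) (H y t) + \<epsilon>" using *[OF N] by linarith
    qed
  qed (use HX t in simp)
  have below: "(d (H x t) (H y s))\<^sup>2 = (t - s)\<^sup>2 + (dist x y)\<^sup>2" if ts: "0 \<le> s" "s < t" for x y t s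
  proof (rule antisym)
    show "(d (H x t) (H y s))\<^sup>2 \<le> (t - s)\<^sup>2 + (dist x y)\<^sup>2" using upper ts by simp
    \<comment> \<open>The point of contact \<open>t\<close> is the midpoint of \<open>s\<close> and \<open>2 * t - s\<close>.\<close>
    have st: "d (H y s) (H y t) = 1/2 * d (H y s) (H y (2 * t - s))"
       "d (H y t) (H y (2 * t - s)) = (1 - 1/2) * d (H y s) (H y (2 * t - s))"
      using Hray ts by simp_all
    have "(d (H x t) (H y t))\<^sup>2 \<le> (1 - 1/2) * (d (H x t) (H y s))\<^sup>2
       + 1/2 * (d (H x t) (H y (2 * t - s)))\<^sup>2 - 1/2 * (1 - 1/2) * (d (H y s) (H y (2 * t - s)))\<^sup>2"
      by (rule stewart[OF _ _ _ _ _ _ st]) (use HX ts in auto)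
    then have "(d (H x t) (H y t))\<^sup>2 \<le> (d (H x t) (H y s))\<^sup>2 / 2
       + (d (H x t) (H y (2 * t - s)))\<^sup>2 / 2 - (d (H y s) (H y (2 * t - s)))\<^sup>2 / 4"
      by simp
    moreover have "(d (H y s) (H y (2 * t - s)))\<^sup>2 = 4 * (t - s)\<^sup>2"
    proof -
      have "d (H y s) (H y (2 * t - s)) = 2 * (t - s)" using Hray[of s "2 * t - s" y] ts by simp
      then show ?thesis by (simp only: power_mult_distrib) simp
    qed
    moreover have "(d (H x t) (H y (2 * t - s)))\<^sup>2 \<le> (t - s)\<^sup>2 + (dist x y)\<^sup>2"
      using upper[of t "2 * t - s" x y] ts by (simp add: power2_commute)
    moreover have "(dist x y)\<^sup>2 \<le> (d (H x t) (H y t))\<^sup>2"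
      using level[of t x y] ts by (intro power_mono) auto
    ultimately show "(t - s)\<^sup>2 + (dist x y)\<^sup>2 \<le> (d (H x t) (H y s))\<^sup>2" by linarith
  qed
  have exact: "(d (H x t) (H y s))\<^sup>2 = (t - s)\<^sup>2 + (dist x y)\<^sup>2" if ts: "0 \<le> s" "0 \<le> t" for x y t s
  proof (rule linorder_cases[of s t])
    assume "s < t" then show ?thesis using below ts by simp
  next
    assume "t < s"
    then show ?thesis using below[of t s y x] ts by (simp add: mdist_commute dist_commute power2_commute)
  next
    assume "s = t"
    then show ?thesis using upper[of t t x y] power_mono[OF level[of t x y], of 2] ts by simp
  qed
  define h where "h = (\<lambda>(x, t). H x t)"
  have "isometric_embedding half_space M h"
    unfolding isometric_embedding_def half_space_def h_def
    by (auto simp: HX dist_prod_def dist_real_def exact intro!: real_sqrt_unique[symmetric])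
  moreover have "h ` (UNIV \<times> {0}) = range e" by (auto simp: h_def H0 image_iff)
  ultimately show ?thesis unfolding bounds_half_flat_def by blast
qed

text \<open>Along the second flat the limit of \<open>d (q n) (e' x) - d (q n) (e 0)\<close> is a convex and bounded
  function of \<open>x\<close>, hence constant.\<close>

lemma far_points_parallel:
  assumes \<omega>: "ultrafilter \<omega>" and q: "\<And>n. q n \<in> X"
    and equi: "\<And>x. ((\<lambda>n. d (q n) (e x) - d (q n) (e 0)) \<longlongrightarrow> 0) \<omega>"
    and e': "flat_in_cat0 M (e' :: real^'k \<Rightarrow> 'a)"
    and near: "\<And>x. \<exists>y. d (e' x) (e y) \<le> B"
  shows "((\<lambda>n. d (q n) (e' x) - d (q n) (e' 0)) \<longlongrightarrow> 0) \<omega>"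
proof -
  interpret F': flat_in_cat0 M e' by (rule e')
  have nb: "\<omega> \<noteq> bot" using \<omega> by (simp add: ultrafilter_def)
  define f where "f x n = d (q n) (e' x) - d (q n) (e 0)" for x n
  have bd: "eventually (\<lambda>n. norm (f x n) \<le> B + 1) \<omega>" for x
  proof -
    obtain y where y: "d (e' x) (e y) \<le> B" using near by blast
    have "eventually (\<lambda>n. dist (d (q n) (e y) - d (q n) (e 0)) 0 < 1) \<omega>"
      using equi[of y] by (rule tendstoD) simp
    then show ?thesis
    proof eventually_elim
      case (elim n)
      then show ?case using d_reverse_triangle[of "e' x" "e y" "q n"] y q
        by (simp add: f_def mdist_commute[of M "q n"])
    qed
  qed
  then have "\<exists>l. (f x \<longlongrightarrow> l) \<omega>" for x by (rule ultra_limit_bounded[OF \<omega>])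
  then obtain u where u: "\<And>x. (f x \<longlongrightarrow> u x) \<omega>" by metis
  have ub: "\<bar>u x\<bar> \<le> B + 1" for x
    using tendsto_le[OF nb tendsto_const tendsto_rabs[OF u[of x]]] bd[of x] by simp
  have conv: "u ((1 - s) *\<^sub>R x + s *\<^sub>R y) \<le> (1 - s) * u x + s * u y" if s: "0 \<le> s" "s \<le> 1" for s x y
  proof (rule tendsto_le[OF nb _ u])
    show "((\<lambda>n. (1 - s) * f x n + s * f y n) \<longlongrightarrow> (1 - s) * u x + s * u y) \<omega>"
      by (intro tendsto_intros u)
    have "f ((1 - s) *\<^sub>R x + s *\<^sub>R y) n \<le> (1 - s) * f x n + s * f y n" for n
      using F'.flat_convex[OF q s, of n x y] by (simp add: f_def algebra_simps)
    then show "eventually (\<lambda>n. f ((1 - s) *\<^sub>R x + s *\<^sub>R y) n \<le> (1 - s) * f x n + s * f y n) \<omega>"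
      by simp
  qed
  have mono: "u y \<le> u x" for x y
  proof (rule field_le_epsilon)
    fix \<epsilon> :: real assume \<epsilon>: "0 < \<epsilon>"
    have B: "0 \<le> B + 1" using ub[of 0] by linarith
    define s where "s = min 1 (\<epsilon> / (2 * (B + 1) + 1))"
    have s: "0 < s" "s \<le> 1" using \<epsilon> B by (simp_all add: s_def)
    define z where "z = x + (y - x) /\<^sub>R s"
    have "(1 - s) *\<^sub>R x + s *\<^sub>R z = y" using s by (simp add: z_def algebra_simps)
    then have "u y \<le> (1 - s) * u x + s * u z" using conv[of s x z] s by simp
    also have "\<dots> = u x + s * (u z - u x)" by (simp add: algebra_simps)
    also have "s * (u z - u x) \<le> s * (2 * (B + 1) + 1)"
      using ub[of z] ub[of x] s by (intro mult_left_mono) auto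
    also have "s * (2 * (B + 1) + 1) \<le> \<epsilon> / (2 * (B + 1) + 1) * (2 * (B + 1) + 1)"
      using B by (intro mult_right_mono) (auto simp: s_def)
    finally show "u y \<le> u x + \<epsilon>" using B by simp
  qed
  then have "u x = u 0" by (simp add: order_antisym)
  then have "((\<lambda>n. f x n - f 0 n) \<longlongrightarrow> 0) \<omega>" using tendsto_diff[OF u[of x] u[of 0]] by simp
  then show ?thesis by (simp add: f_def)
qed

end

section \<open>Volume of thin images\<close>

lemma abs_det_le:
  fixes A :: "real^'n::finite^'n"
  shows "\<bar>det A\<bar> \<le> fact CARD('n) * (\<Prod>i\<in>UNIV. norm (A $ i))"
proof -
  have "\<bar>det A\<bar> \<le> (\<Sum>p\<in>{p. p permutes (UNIV::'n set)}. \<bar>of_int (sign p) * (\<Prod>i\<in>UNIV. A $ i $ p i)\<bar>)"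
    unfolding det_def by (rule sum_abs)
  also have "\<dots> \<le> (\<Sum>p\<in>{p. p permutes (UNIV::'n set)}. (\<Prod>i\<in>UNIV. norm (A $ i)))"
  proof (rule sum_mono)
    fix p :: "'n \<Rightarrow> 'n"
    have "\<bar>of_int (sign p) :: real\<bar> = 1" by (simp add: sign_def)
    then have "\<bar>of_int (sign p) * (\<Prod>i\<in>UNIV. A $ i $ p i)\<bar> = (\<Prod>i\<in>UNIV. \<bar>A $ i $ p i\<bar>)"
      by (simp add: abs_mult abs_prod)
    also have "\<dots> \<le> (\<Prod>i\<in>UNIV. norm (A $ i))"
      by (intro prod_mono) (auto intro: component_le_norm_cart)
    finally show "\<bar>of_int (sign p) * (\<Prod>i\<in>UNIV. A $ i $ p i)\<bar> \<le> (\<Prod>i\<in>UNIV. norm (A $ i))" .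
  qed
  also have "\<dots> = fact CARD('n) * (\<Prod>i\<in>UNIV. norm (A $ i))"
    by (simp add: card_permutations)
  finally show ?thesis .
qed

lemma cramer_rows:
  fixes a :: "'n::finite \<Rightarrow> real^'n"
  assumes "det (\<chi> i. a i) \<noteq> 0"
  shows "v = (\<Sum>k\<in>UNIV. (det (\<chi> i. if i = k then v else a i) / det (\<chi> i. a i)) *\<^sub>R a k)"
proof -
  define B where "B = transpose (\<chi> i. a i)"
  have dB: "det B = det (\<chi> i. a i)" by (simp add: B_def)
  let ?x = "\<chi> k. det (\<chi> i j. if j = k then v $ i else B $ i $ j) / det B"
  have x: "det (\<chi> i j. if j = k then v $ i else B $ i $ j) = det (\<chi> i. if i = k then v else a i)" for k
  proof -
    have "(\<chi> i j. if j = k then v $ i else B $ i $ j) = transpose (\<chi> i. if i = k then v else a i)"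
      by (simp add: B_def transpose_def vec_eq_iff)
    then show ?thesis by simp
  qed
  have "B *v ?x = v" using cramer[of B ?x v] assms dB by simp
  then have "v = (\<Sum>k\<in>UNIV. (?x $ k) *\<^sub>R a k)"
    by (simp add: vec_eq_iff matrix_vector_mult_def B_def transpose_def mult.commute)
  then show ?thesis by (simp add: x dB)
qed

text \<open>The ball is centred at the point with weight \<open>1 / (2 * CARD('n))\<close> at each \<open>p i\<close>: by Cramer's
  rule, a displacement by at most \<open>\<rho>\<close> changes each weight by at most that amount.\<close>

lemma simplex_contains_cball:
  fixes p :: "'n::finite \<Rightarrow> real^'n" and s \<rho> :: real
  assumes V: "0 < \<bar>det (\<chi> i. p i - p0)\<bar>" and s: "\<And>i. norm (p i - p0) \<le> s"
    and \<rho>: "0 \<le> \<rho>" "\<rho> * (2 * CARD('n) * fact CARD('n) * s ^ (CARD('n) - 1)) \<le> \<bar>det (\<chi> i. p i - p0)\<bar>"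
  shows "\<exists>b. cball b \<rho> \<subseteq> convex hull (insert p0 (range p))"
proof -
  define n where "n = real CARD('n)"
  have n: "0 < n" by (simp add: n_def)
  define a where "a i = p i - p0" for i
  define b where "b = p0 + (\<Sum>i\<in>UNIV. (1 / (2 * n)) *\<^sub>R a i)"
  have "y \<in> convex hull (insert p0 (range p))" if y: "y \<in> cball b \<rho>" for y
  proof -
    define v where "v = y - b"
    have v: "norm v \<le> \<rho>" using y by (simp add: v_def dist_norm norm_minus_commute)
    define c where "c k = det (\<chi> i. if i = k then v else a i) / det (\<chi> i. a i)" for k
    have vc: "v = (\<Sum>k\<in>UNIV. c k *\<^sub>R a k)"
      unfolding c_def using V by (intro cramer_rows) (auto simp: a_def)
    have ck: "\<bar>c k\<bar> \<le> 1 / (2 * n)" for k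
    proof -
      have "\<bar>det (\<chi> i. if i = k then v else a i)\<bar> \<le>
          fact CARD('n) * (\<Prod>i\<in>UNIV. norm ((\<chi> i. if i = k then v else a i) $ i))"
        by (rule abs_det_le)
      also have "(\<Prod>i\<in>UNIV. norm ((\<chi> i. if i = k then v else a i) $ i))
          = norm v * (\<Prod>i\<in>UNIV - {k}. norm (a i))"
        by (subst prod.remove[of UNIV k]) (auto intro!: prod.cong)
      also have "(\<Prod>i\<in>UNIV - {k}. norm (a i)) \<le> (\<Prod>i\<in>UNIV - {k}. s)"
        by (intro prod_mono) (simp add: s a_def)
      also have "(\<Prod>i\<in>UNIV - {k}. s) = s ^ (CARD('n) - 1)" by simp
      finally have "\<bar>det (\<chi> i. if i = k then v else a i)\<bar>
          \<le> fact CARD('n) * (norm v * s ^ (CARD('n) - 1))"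
        by (simp add: mult_left_mono)
      also have "\<dots> \<le> fact CARD('n) * (\<rho> * s ^ (CARD('n) - 1))"
        using v order_trans[OF norm_ge_zero s] by (intro mult_left_mono mult_right_mono) auto
      also have "\<dots> \<le> \<bar>det (\<chi> i. a i)\<bar> / (2 * n)"
        using \<rho>(2) n by (simp add: n_def a_def field_simps)
      finally show ?thesis using V n by (simp add: c_def a_def abs_divide divide_le_eq)
    qed
    define l where "l i = 1 / (2 * n) + c i" for i
    have l0: "0 \<le> l i" and l1: "l i \<le> 1 / n" for i
      using ck[of i] n by (auto simp: l_def abs_le_iff field_simps)
    have "(\<Sum>i\<in>UNIV. l i) \<le> (\<Sum>i\<in>(UNIV::'n set). 1 / n)" by (intro sum_mono l1)
    then have suml: "(\<Sum>i\<in>UNIV. l i) \<le> 1" using n by (simp add: n_def)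
    have "y = p0 + (\<Sum>i\<in>UNIV. l i *\<^sub>R a i)"
      using vc by (simp add: v_def b_def l_def scaleR_add_left sum.distrib algebra_simps)
    also have "\<dots> = (1 - (\<Sum>i\<in>UNIV. l i)) *\<^sub>R p0 + (\<Sum>i\<in>UNIV. l i *\<^sub>R p i)"
      by (simp add: a_def scaleR_diff_right sum_subtractf scaleR_left.sum algebra_simps)
    also have "\<dots> = (\<Sum>j\<in>UNIV. (case j of None \<Rightarrow> 1 - (\<Sum>i\<in>UNIV. l i) | Some i \<Rightarrow> l i) *\<^sub>R
                          (case j of None \<Rightarrow> p0 | Some i \<Rightarrow> p i))"
      by (simp add: UNIV_option_conv sum.reindex)
    also have "\<dots> \<in> convex hull (insert p0 (range p))"
    proof (rule convex_sum)
      show "(\<Sum>j\<in>UNIV. case j of None \<Rightarrow> 1 - (\<Sum>i\<in>UNIV. l i) | Some i \<Rightarrow> l i) = 1"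
        by (simp add: UNIV_option_conv sum.reindex)
    qed (auto simp: l0 suml split: option.split intro: hull_inc)
    finally show ?thesis .
  qed
  then show ?thesis by blast
qed

text \<open>The points of \<open>S\<close> spanning an almost maximal simplex have, by Cramer's rule, all of \<open>S\<close>
  inside a parallelepiped of comparable volume.\<close>

lemma measure_le_simplices:
  fixes S :: "(real^'n::{finite,wellorder}) set"
  assumes S: "S \<in> lmeasurable" and p0: "p0 \<in> S"
    and V: "\<And>p. range p \<subseteq> S \<Longrightarrow> \<bar>det (\<chi> i. p i - p0)\<bar> \<le> V"
  shows "measure lebesgue S \<le> 4 ^ CARD('n::{finite,wellorder}) * V"
proof -
  define Z where "Z = {\<bar>det (\<chi> i. p i - p0)\<bar> |p. range p \<subseteq> S}"
  define W where "W = Sup Z"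
  have bdd: "bdd_above Z" using V unfolding Z_def by (intro bdd_aboveI[of _ V]) auto
  have zero: "det (\<chi> i. (\<lambda>_. p0) i - p0) = (0::real)"
    by (rule det_zero_row(1)[of undefined]) (simp add: row_def vec_eq_iff)
  then have Z0: "0 \<in> Z" using p0 unfolding Z_def by (intro CollectI exI[of _ "\<lambda>_. p0"]) auto
  have W0: "0 \<le> W" unfolding W_def using cSup_upper[OF Z0 bdd] .
  have V0: "0 \<le> V" using V[of "\<lambda>_. p0"] p0 by (auto intro: order_trans[OF abs_ge_zero])
  have le_W: "\<bar>det (\<chi> i. p i - p0)\<bar> \<le> W" if "range p \<subseteq> S" for p
    unfolding W_def using that by (intro cSup_upper[OF _ bdd]) (auto simp: Z_def)
  show ?thesis
  proof (cases "W = 0")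
    case True
    define T where "T = (\<lambda>x. x - p0) ` S"
    have "dim T < CARD('n::{finite,wellorder})"
    proof (rule ccontr)
      assume "\<not> ?thesis"
      then have dT: "dim T = CARD('n::{finite,wellorder})" using dim_subset_UNIV[of T] by simp
      obtain B where B: "B \<subseteq> T" "independent B" "T \<subseteq> span B" "card B = dim T"
        using basis_exists[of T] by metis
      have "finite B" using independent_imp_finite B(2) by blast
      then obtain f :: "'n::{finite,wellorder} \<Rightarrow> _" where f: "bij_betw f UNIV B"
        using finite_same_card_bij[OF finite_class.finite_UNIV \<open>finite B\<close>] B(4) dT by metis
      have "rows (\<chi> i. f i) = B" using f by (auto simp: rows_def row_def bij_betw_def vec_lambda_eta)
      then have "rank (\<chi> i. f i) = CARD('n::{finite,wellorder})"
        using B(2,4) dT by (simp add: row_rank_def dim_eq_card_independent)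
      then have "det (\<chi> i. f i) \<noteq> 0" using det_eq_0_rank by (metis less_irrefl)
      moreover have "range (\<lambda>i. f i + p0) \<subseteq> S"
        using f B(1) by (auto simp: T_def bij_betw_def)
      ultimately show False using le_W[of "\<lambda>i. f i + p0"] True by simp
    qed
    then have "negligible T" by (intro negligible_lowdim) simp
    then have "negligible ((+) p0 ` T)" by (rule negligible_translation)
    then have "negligible S" by (rule negligible_subset) (auto simp: T_def image_image)
    then show ?thesis using V0 by (simp add: negligible_imp_measure0)
  next
    case False
    then have "W / 2 < W" using W0 by simp
    \<comment> \<open>The supremum may not be attained; losing a factor \<open>2\<close> makes the coefficients range over
      \<open>[-2, 2]\<close>.\<close>
    then have "W / 2 < Sup Z" by (simp add: W_def)
    then have "\<exists>x\<in>Z. W / 2 < x" using less_cSupD[of Z "W / 2"] Z0 by blast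
    then obtain p where p: "range p \<subseteq> S" "W / 2 < \<bar>det (\<chi> i. p i - p0)\<bar>"
      by (auto simp: Z_def)
    define a where "a i = p i - p0" for i
    define B where "B = transpose (\<chi> i. a i)"
    have Bx: "B *v x = (\<Sum>k\<in>UNIV. x $ k *\<^sub>R a k)" for x
      by (simp add: vec_eq_iff matrix_vector_mult_def B_def transpose_def mult.commute)
    have nz: "det (\<chi> i. a i) \<noteq> 0" and detpos: "W \<le> 2 * \<bar>det (\<chi> i. a i)\<bar>"
      using p(2) W0 by (auto simp: a_def)
    have sub: "S \<subseteq> (+) p0 ` ((*v) B ` cbox (-2) 2)"
    proof
      fix y assume y: "y \<in> S"
      define c where "c = (\<chi> k. det (\<chi> i. if i = k then y - p0 else a i) / det (\<chi> i. a i))"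
      have "y - p0 = B *v c"
        unfolding Bx c_def using cramer_rows[OF nz, of "y - p0"] by simp
      moreover have "\<bar>c $ k\<bar> \<le> 2" for k
      proof -
        have "(\<chi> i. if i = k then y - p0 else a i) = (\<chi> i. (if i = k then y else p i) - p0)"
          by (simp add: a_def vec_eq_iff)
        moreover have "range (\<lambda>i. if i = k then y else p i) \<subseteq> S" using p(1) y by auto
        ultimately have "\<bar>det (\<chi> i. if i = k then y - p0 else a i)\<bar> \<le> W"
          using le_W[of "\<lambda>i. if i = k then y else p i"] by simp
        then show ?thesis using detpos nz by (simp add: c_def abs_divide divide_le_eq)
      qed
      then have "c \<in> cbox (-2) 2" by (auto simp: mem_box_cart abs_le_iff) (smt (verit))+
      moreover have "y = p0 + (y - p0)" by simp
      ultimately show "y \<in> (+) p0 ` ((*v) B ` cbox (-2) 2)" by (metis image_eqI)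
    qed
    have lin: "linear ((*v) B)" by (rule matrix_vector_mul_linear)
    have box: "cbox (-2) (2::real^'n::{finite,wellorder}) \<in> lmeasurable" by simp
    have m2: "(*v) B ` cbox (-2) 2 \<in> lmeasurable" using measurable_linear_image[OF lin box] .
    have mbox: "measure lebesgue (cbox (-2) (2::real^'n::{finite,wellorder})) = 4 ^ CARD('n)"
      by (simp add: content_cbox_cart interval_ne_empty_cart(1))
    have "measure lebesgue S \<le> measure lebesgue ((+) p0 ` ((*v) B ` cbox (-2) 2))"
      using m2 S by (intro measure_mono_fmeasurable sub measurable_translation) auto
    also have "\<dots> = \<bar>det (matrix ((*v) B))\<bar> * 4 ^ CARD('n)"
      using measure_linear_image[OF lin box] by (simp add: measure_translation mbox)
    also have "det (matrix ((*v) B)) = det (\<chi> i. a i)" by (simp add: B_def)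
    also have "\<bar>det (\<chi> i. a i)\<bar> * 4 ^ CARD('n) \<le> V * 4 ^ CARD('n)"
      using V[OF p(1)] by (intro mult_right_mono) (simp_all add: a_def)
    finally show ?thesis by (simp add: mult.commute)
  qed
qed

text \<open>If the convex hull of the image of a ball of radius \<open>r\<close> contains only balls of radius
  \<open>O(r\<^sup>2)\<close>, then the simplices with vertices in this image have volume \<open>O(r ^ (n + 1))\<close>, and so has
  the image.  As a cube is covered by \<open>O(1 / r ^ n)\<close> such balls, its image has volume \<open>O(r)\<close> for
  every small \<open>r\<close>.  But a continuous map at bounded distance from the identity covers a ball, by
  Brouwer's theorem.\<close>

lemma no_thin_map_wellorder:
  fixes \<Psi> :: "real^'n::{finite,wellorder} \<Rightarrow> real^'n::_"
  assumes lip: "\<And>x y. dist (\<Psi> x) (\<Psi> y) \<le> \<Lambda> * dist x y" and \<Lambda>: "0 < \<Lambda>"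
    and near: "\<And>x. dist (\<Psi> x) x \<le> C" and C: "0 < C" and K: "0 \<le> K" and r0: "0 < r0"
    and thin: "\<And>z r \<rho> T b. 0 < r \<Longrightarrow> r < r0 \<Longrightarrow> 0 < \<rho> \<Longrightarrow> finite T \<Longrightarrow> T \<subseteq> cball z r \<Longrightarrow>
      cball b \<rho> \<subseteq> convex hull (\<Psi> ` T) \<Longrightarrow> \<rho> \<le> K * r\<^sup>2"
  shows False
proof -
  define n where "n = CARD('n)"
  have n: "0 < n" by (simp add: n_def)
  have cont: "continuous_on S \<Psi>" for S
    using lip \<Lambda> by (intro lipschitz_on_continuous_on[of \<Lambda>] lipschitz_onI) auto
  have comp: "compact (\<Psi> ` cball z r)" for z r
    by (intro compact_continuous_image cont compact_cball)
  define c1 where "c1 = 2 * n * fact n * (2 * \<Lambda>) ^ (n - 1) * K"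
  have c1: "0 \<le> c1" using \<Lambda> K by (simp add: c1_def)
  have ball: "measure lebesgue (\<Psi> ` cball z r) \<le> 4 ^ n * (c1 * r ^ (n + 1))" if r: "0 < r" "r < r0" for z r
    unfolding n_def
  proof (rule measure_le_simplices)
    show "\<Psi> ` cball z r \<in> lmeasurable" by (rule lmeasurable_compact[OF comp])
    show "\<Psi> z \<in> \<Psi> ` cball z r" using r by simp
    fix p :: "'n::{finite,wellorder} \<Rightarrow> real^'n::_" assume p: "range p \<subseteq> \<Psi> ` cball z r"
    let ?V = "\<bar>det (\<chi> i. p i - \<Psi> z)\<bar>"
    define s where "s = 2 * \<Lambda> * r"
    define m where "m = 2 * n * fact n * s ^ (n - 1)"
    have s: "0 < s" using r \<Lambda> by (simp add: s_def)
    have m: "0 < m" using s n by (simp add: m_def)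
    show "?V \<le> c1 * r ^ (CARD('n) + 1)"
    proof (cases "?V = 0")
      case True
      then show ?thesis using c1 r by simp
    next
      case False
      have "norm (p i - \<Psi> z) \<le> s" for i
      proof -
        obtain x where x: "x \<in> cball z r" "p i = \<Psi> x" using p by blast
        have "dist (\<Psi> x) (\<Psi> z) \<le> \<Lambda> * r"
          using lip[of x z] x(1) \<Lambda> by (smt (verit) dist_commute mem_cball mult_left_mono)
        also have "\<dots> \<le> s" using r \<Lambda> by (simp add: s_def)
        finally show ?thesis using x by (simp add: dist_norm)
      qed
      then have "\<exists>b. cball b (?V / m) \<subseteq> convex hull (insert (\<Psi> z) (range p))"
        using False m by (intro simplex_contains_cball[where s = s]) (auto simp: m_def n_def)
      then obtain b where b: "cball b (?V / m) \<subseteq> convex hull (insert (\<Psi> z) (range p))" by blast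
      have "\<exists>x. x \<in> cball z r \<and> p i = \<Psi> x" for i using p by blast
      then obtain x where x: "\<And>i. x i \<in> cball z r" "p = (\<lambda>i. \<Psi> (x i))" by metis
      have "insert (\<Psi> z) (range p) = \<Psi> ` insert z (range x)" unfolding x(2) by blast
      then have b': "cball b (?V / m) \<subseteq> convex hull (\<Psi> ` insert z (range x))" using b by simp
      have "0 < ?V / m" using False m by simp
      moreover have "insert z (range x) \<subseteq> cball z r" using x(1) r by auto
      ultimately have "?V / m \<le> K * r\<^sup>2"
        by (intro thin[OF r _ _ _ b']) auto
      then have "?V \<le> K * r\<^sup>2 * m" using m by (simp add: divide_le_eq)
      also have "\<dots> = c1 * (r ^ (n - 1) * r\<^sup>2)"
        by (simp add: m_def c1_def s_def power_mult_distrib)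
      also have "r ^ (n - 1) * r\<^sup>2 = r ^ (n + 1)"
        using n by (simp flip: power_add)
      finally show ?thesis by (simp add: n_def)
    qed
  qed
  define R where "R = 2 * C"
  have R: "0 < R" using C by (simp add: R_def)
  define Q where "Q = cbox (\<chi> i. - R) ((\<chi> i. R) :: real^'n::{finite,wellorder})"
  have Qc: "compact (\<Psi> ` Q)" unfolding Q_def by (intro compact_continuous_image cont compact_cbox)
  define c2 where "c2 = 4 ^ n * (c1 * (n * (2 * R)) ^ (n + 1))"
  have cover: "measure lebesgue (\<Psi> ` Q) \<le> c2 / N" if N: "N > 0" "n * (2 * R) / N < r0" for N :: nat
  proof -
    define \<delta> where "\<delta> = 2 * R / N"
    have \<delta>: "0 < \<delta>" using R N by (simp add: \<delta>_def)
    have r: "0 < n * \<delta>" using \<delta> n by simp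
    have r': "n * \<delta> < r0" using N by (simp add: \<delta>_def)
    define I where "I = (UNIV :: 'n::{finite,wellorder} set) \<rightarrow>\<^sub>E {..<N}"
    define z where "z m = (\<chi> i. m i * \<delta> - R)" for m :: "'n::{finite,wellorder} \<Rightarrow> nat"
    have fI: "finite I" and cI: "card I = N ^ n"
      by (auto simp: I_def n_def card_PiE intro: finite_PiE)
    have "Q \<subseteq> (\<Union>m\<in>I. cball (z m) (n * \<delta>))"
    proof
      fix x assume x: "x \<in> Q"
      then have xi: "- R \<le> x $ i" "x $ i \<le> R" for i by (auto simp: Q_def mem_box_cart)
      \<comment> \<open>The upper end \<open>R\<close> of the range of a coordinate belongs to the last cell.\<close>
      define m where "m = (\<lambda>i. min (N - 1) (nat \<lfloor>(x $ i + R) / \<delta>\<rfloor>))"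
      have "m \<in> I" using N by (auto simp: I_def m_def)
      moreover have "\<bar>x $ i - z m $ i\<bar> \<le> \<delta>" for i
      proof -
        define y where "y = (x $ i + R) / \<delta>"
        have "N * \<delta> = 2 * R" using N by (simp add: \<delta>_def)
        then have y: "0 \<le> y" "y \<le> N" "x $ i = y * \<delta> - R"
          using xi[of i] \<delta> by (simp_all add: y_def divide_le_eq)
        have "\<bar>y - m i\<bar> \<le> 1"
        proof (cases "nat \<lfloor>y\<rfloor> \<le> N - 1")
          case True
          then have "m i = nat \<lfloor>y\<rfloor>" by (simp add: m_def y_def)
          then show ?thesis using y(1) by linarith
        next
          case False
          then have "m i = N - 1" by (simp add: m_def y_def)
          moreover have "real N \<le> y" using False N y by linarith
          ultimately show ?thesis using y N by (simp add: of_nat_diff)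
        qed
        then have "\<bar>y - m i\<bar> * \<delta> \<le> 1 * \<delta>" using \<delta> by (intro mult_right_mono) auto
        moreover have "x $ i - z m $ i = (y - m i) * \<delta>" by (simp add: z_def y(3) algebra_simps)
        ultimately show ?thesis using \<delta> by (simp add: abs_mult)
      qed
      then have "norm (x - z m) \<le> n * \<delta>"
      proof -
        have "norm (x - z m) \<le> (\<Sum>i\<in>UNIV. \<bar>(x - z m) $ i\<bar>)" by (rule norm_le_l1_cart)
        also have "\<dots> \<le> (\<Sum>i\<in>(UNIV::'n::{finite,wellorder} set). \<delta>)"
          using \<open>\<And>i. \<bar>x $ i - z m $ i\<bar> \<le> \<delta>\<close> by (intro sum_mono) simp
        finally show ?thesis by (simp add: n_def)
      qed
      ultimately show "x \<in> (\<Union>m\<in>I. cball (z m) (n * \<delta>))"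
        by (auto simp: dist_norm norm_minus_commute)
    qed
    then have "\<Psi> ` Q \<subseteq> (\<Union>m\<in>I. \<Psi> ` cball (z m) (n * \<delta>))" by blast
    then have "measure lebesgue (\<Psi> ` Q) \<le> measure lebesgue (\<Union>m\<in>I. \<Psi> ` cball (z m) (n * \<delta>))"
      using lmeasurable_compact[OF comp] lmeasurable_compact[OF Qc] fI
      by (intro measure_mono_fmeasurable) (auto intro!: fmeasurable.finite_UN)
    also have "\<dots> \<le> (\<Sum>m\<in>I. measure lebesgue (\<Psi> ` cball (z m) (n * \<delta>)))"
      using lmeasurable_compact[OF comp] fI by (intro measure_UNION_le) auto
    also have "\<dots> \<le> (\<Sum>m\<in>I. 4 ^ n * (c1 * (n * \<delta>) ^ (n + 1)))"
      using ball[OF r r'] by (intro sum_mono) auto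
    also have "\<dots> = c2 / N"
      using N by (simp add: cI c2_def \<delta>_def power_divide field_simps)
    finally show ?thesis .
  qed
  have "measure lebesgue (\<Psi> ` Q) \<le> 0"
  proof (rule field_le_epsilon)
    fix \<epsilon> :: real assume \<epsilon>: "0 < \<epsilon>"
    have c2: "0 \<le> c2" using c1 R by (simp add: c2_def)
    obtain N :: nat where N: "max (c2 / \<epsilon>) (n * (2 * R) / r0) < N" using reals_Archimedean2 by blast
    have "0 < n * (2 * R) / r0" using R r0 n by simp
    then have N0: "0 < N" using N by (simp only: max_less_iff_conj) (metis order_less_trans of_nat_0_less_iff)
    have "n * (2 * R) / N < r0" using N N0 r0 by (simp add: field_simps)
    then have "measure lebesgue (\<Psi> ` Q) \<le> c2 / N" by (rule cover[OF N0])
    also have "\<dots> \<le> \<epsilon>" using N N0 \<epsilon> by (simp add: field_simps)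
    finally show "measure lebesgue (\<Psi> ` Q) \<le> 0 + \<epsilon>" by simp
  qed
  moreover have "measure lebesgue (cball (0::real^'n::{finite,wellorder}) C) \<le> measure lebesgue (\<Psi> ` Q)"
  proof (rule measure_mono_fmeasurable)
    show "cball 0 C \<subseteq> \<Psi> ` Q"
    proof
      fix x :: "real^'n::{finite,wellorder}" assume x: "x \<in> cball 0 C"
      have "\<exists>y\<in>cball 0 R. \<Psi> y = x"
      proof (rule brouwer_surjective_cball[OF cont R x])
        fix x' y :: "real^'n::{finite,wellorder}" assume "x' \<in> cball 0 C" "y \<in> cball 0 R"
        then have "norm x' \<le> C" "norm (y - \<Psi> y) \<le> C" using near[of y] by (auto simp: dist_norm norm_minus_commute)
        then show "x' + (y - \<Psi> y) \<in> cball 0 R"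
          using norm_triangle_ineq[of x' "y - \<Psi> y"] by (simp add: R_def)
      qed
      moreover have "cball 0 R \<subseteq> Q"
      proof
        fix y :: "real^'n::{finite,wellorder}" assume "y \<in> cball 0 R"
        then have "\<bar>y $ i\<bar> \<le> R" for i using component_le_norm_cart[of y i] by simp
        then show "y \<in> Q" by (auto simp: Q_def mem_box_cart abs_le_iff) (smt (verit))
      qed
      ultimately show "x \<in> \<Psi> ` Q" by blast
    qed
  qed (auto intro: lmeasurable_compact[OF Qc])
  moreover have "0 < measure lebesgue (cball (0::real^'n::{finite,wellorder}) C)"
    using content_cball_pos[OF C] by simp
  ultimately show False by simp
qed

text \<open>A copy of a finite type that carries a well-order, as the index types in
  \<open>measure_linear_image\<close> do.\<close>

typedef ('k::finite) ordered_index = "{..<CARD('k)}"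
  by (intro exI[of _ 0]) simp

instantiation ordered_index :: (finite) linorder
begin

definition "x \<le> y \<longleftrightarrow> Rep_ordered_index x \<le> Rep_ordered_index y"
definition "x < y \<longleftrightarrow> Rep_ordered_index x < Rep_ordered_index y"

instance
  by standard (auto simp: less_eq_ordered_index_def less_ordered_index_def Rep_ordered_index_inject)

end

instance ordered_index :: (finite) wellorder
proof
  fix P :: "'a ordered_index \<Rightarrow> bool" and a :: "'a ordered_index"
  assume step: "\<And>x. (\<And>y. y < x \<Longrightarrow> P y) \<Longrightarrow> P x"
  show "P a"
    by (induction a rule: measure_induct_rule[of Rep_ordered_index])
       (auto intro: step simp: less_ordered_index_def)
qed

instance ordered_index :: (finite) finite
proof
  have "(UNIV :: 'a ordered_index set) = Abs_ordered_index ` {..<CARD('a)}"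
    using type_definition.Abs_image[OF type_definition_ordered_index] by metis
  then show "finite (UNIV :: 'a ordered_index set)"
    using finite_imageI[OF finite_lessThan] by metis
qed

lemma card_ordered_index: "CARD('k::finite ordered_index) = CARD('k)"
  using type_definition.card[OF type_definition_ordered_index] by simp

text \<open>Relabelling the coordinates is an isometry, and the assumptions are invariant under
  isometries.\<close>

theorem no_thin_map:
  fixes \<Psi> :: "real^'k::finite \<Rightarrow> real^'k"
  assumes lip: "\<And>x y. dist (\<Psi> x) (\<Psi> y) \<le> \<Lambda> * dist x y" and \<Lambda>: "0 < \<Lambda>"
    and near: "\<And>x. dist (\<Psi> x) x \<le> C" and C: "0 < C" and K: "0 \<le> K" and r0: "0 < r0"
    and thin: "\<And>z r \<rho> T b. 0 < r \<Longrightarrow> r < r0 \<Longrightarrow> 0 < \<rho> \<Longrightarrow> finite T \<Longrightarrow> T \<subseteq> cball z r \<Longrightarrow>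
      cball b \<rho> \<subseteq> convex hull (\<Psi> ` T) \<Longrightarrow> \<rho> \<le> K * r\<^sup>2"
  shows False
proof -
  obtain \<beta> :: "'k \<Rightarrow> 'k ordered_index" where \<beta>: "bij \<beta>"
    using finite_same_card_bij[OF finite_class.finite_UNIV finite_class.finite_UNIV
        card_ordered_index[where 'k = 'k, symmetric]] by metis
  define g :: "real^'k ordered_index \<Rightarrow> real^'k" where "g x = (\<chi> i. x $ \<beta> i)" for x
  define g' :: "real^'k \<Rightarrow> real^'k ordered_index" where "g' x = (\<chi> i. x $ (inv_into UNIV \<beta> i))" for x
  have gg': "g (g' x) = x" and g'g: "g' (g y) = y" for x y
    using \<beta> by (simp_all add: g_def g'_def vec_eq_iff bij_is_inj inv_f_f bij_is_surj surj_f_inv_f)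
  have lin: "linear g" by (intro linearI) (simp_all add: g_def vec_eq_iff)
  have ng: "norm (g x) = norm x" for x
  proof -
    have "(\<Sum>i\<in>UNIV. (x $ \<beta> i)\<^sup>2) = (\<Sum>i\<in>UNIV. (x $ i)\<^sup>2)"
      using sum.reindex_bij_betw[OF \<beta>, of "\<lambda>i. (x $ i)\<^sup>2"] by simp
    then show ?thesis by (simp add: norm_vec_def L2_set_def g_def)
  qed
  have dg: "dist (g x) (g y) = dist x y" for x y
    using ng[of "x - y"] by (simp add: dist_norm linear_diff[OF lin])
  have dg': "dist (g' x) (g' y) = dist x y" for x y
    using dg[of "g' x" "g' y"] by (simp add: gg')
  have gb: "g ` cball b \<rho> = cball (g b) \<rho>" for b \<rho>
  proof
    show "cball (g b) \<rho> \<subseteq> g ` cball b \<rho>"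
      by (metis dg gg' image_eqI mem_cball subsetI)
  qed (auto simp: dg)
  define \<Psi>' where "\<Psi>' = g' \<circ> \<Psi> \<circ> g"
  show False
  proof (rule no_thin_map_wellorder[of \<Psi>' \<Lambda> C K r0])
    show "dist (\<Psi>' x) (\<Psi>' y) \<le> \<Lambda> * dist x y" for x y
      using lip[of "g x" "g y"] by (simp add: \<Psi>'_def dg dg')
    show "dist (\<Psi>' x) x \<le> C" for x
      using near[of "g x"] dg[of "\<Psi>' x" x] by (simp add: \<Psi>'_def gg')
    fix z r b \<rho> T
    assume r: "0 < r" "r < r0" "0 < \<rho>" and T: "finite T" "T \<subseteq> cball z r"
      and sub: "cball b \<rho> \<subseteq> convex hull (\<Psi>' ` T)"
    have "cball (g b) \<rho> \<subseteq> g ` (convex hull (\<Psi>' ` T))"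
      using image_mono[OF sub, of g] by (simp add: gb)
    also have "\<dots> = convex hull (g ` \<Psi>' ` T)" by (rule convex_hull_linear_image[OF lin])
    also have "g ` \<Psi>' ` T = \<Psi> ` g ` T"
      by (simp add: \<Psi>'_def image_comp o_def gg')
    finally show "\<rho> \<le> K * r\<^sup>2"
      using T image_mono[OF T(2), of g] by (intro thin[OF r]) (auto simp: gb)
  qed (fact \<Lambda> C K r0)+
qed

section \<open>Flat sublevel sets of distance functions\<close>

lemma cball_subset_hull_perturb:
  fixes f g :: "'b \<Rightarrow> 'v::euclidean_space"
  assumes T: "finite T" and sub: "cball b \<rho> \<subseteq> convex hull (f ` T)" and fg: "\<And>t. t \<in> T \<Longrightarrow> dist (g t) (f t) \<le> \<eta>"
    and \<eta>: "0 \<le> \<eta>"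
  shows "cball b (\<rho> - \<eta>) \<subseteq> convex hull (g ` T)"
proof (rule ccontr)
  assume "\<not> ?thesis"
  then obtain x where x: "x \<in> cball b (\<rho> - \<eta>)" "x \<notin> convex hull (g ` T)" by blast
  have "closed (convex hull (g ` T))"
    using T by (intro compact_imp_closed finite_imp_compact_convex_hull) auto
  then obtain a c where ac: "a \<bullet> x < c" "\<forall>y\<in>convex hull (g ` T). c < a \<bullet> y"
    using separating_hyperplane_closed_point[of "convex hull (g ` T)" x] x(2) by auto
  have a0: "a \<noteq> 0"
  proof
    assume "a = 0"
    moreover have "T \<noteq> {}"
    proof
      assume "T = {}"
      then have "cball b \<rho> = {}" using sub by simp
      moreover have "cball b (\<rho> - \<eta>) \<subseteq> cball b \<rho>" using \<eta> by auto
      ultimately show False using x(1) by auto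
    qed
    ultimately show False using ac hull_subset[of "g ` T" convex] by fastforce
  qed
  \<comment> \<open>Moving \<open>x\<close> by \<open>\<eta>\<close> in the direction \<open>- a\<close> keeps it in the larger ball but off the hull of \<open>f ` T\<close>.\<close>
  define u where "u = a /\<^sub>R norm a"
  have au: "a \<bullet> u = norm a" "norm u = 1"
    using a0 by (simp_all add: u_def power2_norm_eq_inner[symmetric] power2_eq_square)
  have "x - \<eta> *\<^sub>R u \<in> cball b \<rho>"
  proof -
    have "dist b (x - \<eta> *\<^sub>R u) \<le> dist b x + dist x (x - \<eta> *\<^sub>R u)" by (rule dist_triangle)
    also have "dist x (x - \<eta> *\<^sub>R u) = \<eta>" using \<eta> au by (simp add: dist_norm)
    finally show ?thesis using x(1) by simp
  qed
  then have mem: "x - \<eta> *\<^sub>R u \<in> convex hull (f ` T)" using sub by blast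
  have "convex hull (f ` T) \<subseteq> {y. c - \<eta> * norm a \<le> a \<bullet> y}"
  proof (rule hull_minimal)
    show "f ` T \<subseteq> {y. c - \<eta> * norm a \<le> a \<bullet> y}"
    proof clarify
      fix t assume t: "t \<in> T"
      have "c < a \<bullet> g t" using ac(2) t hull_inc[of "g t" "g ` T" convex] by auto
      moreover have "a \<bullet> (g t - f t) \<le> norm a * \<eta>"
        using norm_cauchy_schwarz[of a "g t - f t"] fg[OF t]
        by (smt (verit) dist_norm mult_left_mono norm_ge_zero)
      ultimately show "c - \<eta> * norm a \<le> a \<bullet> f t" by (simp add: inner_diff_right mult.commute)
    qed
  qed (rule convex_halfspace_ge)
  with mem have "c - \<eta> * norm a \<le> a \<bullet> (x - \<eta> *\<^sub>R u)" by blast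
  then show False using ac(1) au by (simp add: inner_diff_right)
qed

context flat_in_cat0 begin

definition sublevel :: "'a \<Rightarrow> real \<Rightarrow> (real^'k) set" where
  "sublevel q \<delta> = {x. d q (e x) \<le> d q (e (proj q)) + \<delta>}"

lemma convex_sublevel: "q \<in> X \<Longrightarrow> convex (sublevel q \<delta>)"
  unfolding sublevel_def convex_alt
  using flat_convex[of q] convex_bound_le
  by (simp, smt (verit, ccfv_SIG) mult_left_mono right_diff_distrib)

text \<open>A homothety towards the nearest point shrinks a large ball in a high sublevel set to a
  ball in a low one.\<close>

lemma sublevel_shrink:
  assumes q: "q \<in> X" and \<epsilon>: "0 < \<epsilon>" "\<epsilon> \<le> \<delta>" and sub: "cball b \<rho> \<subseteq> sublevel q \<delta>"
    and R: "R * \<delta> \<le> \<rho> * \<epsilon>"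
  shows "\<exists>b'. cball b' R \<subseteq> sublevel q \<epsilon>"
proof -
  define s where "s = \<epsilon> / \<delta>"
  have s: "0 < s" "s \<le> 1" "s * \<delta> = \<epsilon>" "R \<le> s * \<rho>" using \<epsilon> R by (simp_all add: s_def field_simps)
  define b' where "b' = (1 - s) *\<^sub>R proj q + s *\<^sub>R b"
  have "x \<in> sublevel q \<epsilon>" if x: "x \<in> cball b' R" for x
  proof -
    define y where "y = b + (x - b') /\<^sub>R s"
    have xy: "x = (1 - s) *\<^sub>R proj q + s *\<^sub>R y"
      using s by (simp add: y_def b'_def algebra_simps)
    have "norm (x - b') \<le> s * \<rho>" using x s by (simp add: dist_norm norm_minus_commute)
    then have "dist b y \<le> \<rho>" using s by (simp add: y_def dist_norm divide_inverse[symmetric] divide_le_eq mult.commute inverse_eq_divide)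
    then have "d q (e y) \<le> d q (e (proj q)) + \<delta>" using sub by (auto simp: sublevel_def)
    then have "s * d q (e y) \<le> s * (d q (e (proj q)) + \<delta>)" using s by (intro mult_left_mono) auto
    then have "d q (e x) \<le> (1 - s) * d q (e (proj q)) + s * (d q (e (proj q)) + \<delta>)"
      using flat_convex[OF q, of s "proj q" y] s unfolding xy by linarith
    also have "\<dots> = d q (e (proj q)) + \<epsilon>" using s(3) by (simp add: algebra_simps)
    finally show ?thesis by (simp add: sublevel_def)
  qed
  then show ?thesis by blast
qed

text \<open>The nearest points of the \<open>b t j\<close> with \<open>t\<close> in a ball of radius \<open>r\<close> lie, by
  \<open>proj_of_nearby\<close>, in a sublevel set of height \<open>O(r\<^sup>2 * scal j)\<close>.  If no far point had a low sublevel
  set containing a ball of radius \<open>R\<close>, then by \<open>sublevel_shrink\<close> their hull would contain only balls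
  of radius \<open>O(r\<^sup>2 * scal j)\<close>, and the ultralimit of the rescaled nearest point maps would be a map
  that \<open>no_thin_map\<close> excludes.\<close>

theorem flat_sublevels:
  fixes b :: "real^'k \<Rightarrow> nat \<Rightarrow> 'a" and scal :: "nat \<Rightarrow> real"
  assumes \<omega>: "ultrafilter \<omega>" and scal: "\<And>j. 0 < scal j" "filterlim scal at_top \<omega>"
    and b: "\<And>z j. b z j \<in> X"
    and lip: "\<And>z z' \<delta>. 0 < \<delta> \<Longrightarrow> eventually (\<lambda>j. d (b z j) (b z' j) \<le> (\<Lambda> * dist z z' + \<delta>) * scal j) \<omega>"
    and near: "\<And>z. eventually (\<lambda>j. d (b z j) (e (scal j *\<^sub>R z)) \<le> C * scal j) \<omega>"
    and away: "\<And>z. eventually (\<lambda>j. \<forall>w. c * scal j \<le> d (b z j) (e w)) \<omega>"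
    and pos: "0 < \<Lambda>" "0 < C" "0 < c"
    and R: "0 < R" and \<epsilon>: "0 < \<epsilon>"
  shows "\<exists>q\<in>X. N \<le> d q (e (proj q)) \<and> (\<exists>b'. cball b' R \<subseteq> sublevel q \<epsilon>)"
proof (rule ccontr)
  assume no: "\<not> ?thesis"
  have nb: "\<omega> \<noteq> bot" using \<omega> by (simp add: ultrafilter_def)
  define P where "P z j = proj (b z j) /\<^sub>R scal j" for z j
  have Pdist: "dist (P z j) (P z' j) = dist (proj (b z j)) (proj (b z' j)) / scal j" for z z' j
    using scal(1)[of j] by (simp add: P_def dist_norm divide_inverse flip: scaleR_diff_right)
  have Pnear: "eventually (\<lambda>j. dist (P z j) z \<le> 2 * C) \<omega>" for z
    using near[of z]
  proof eventually_elim
    case (elim j)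
    have "d (b z j) (e (proj (b z j))) \<le> C * scal j" using proj_le[OF b] elim by (rule order_trans)
    then have "dist (proj (b z j)) (scal j *\<^sub>R z) \<le> 2 * C * scal j"
      using mdist_triangle[of "e (proj (b z j))" M "b z j" "e (scal j *\<^sub>R z)"] b elim
      by (simp add: mdist_commute[of M _ "b z j"])
    moreover have "P z j - z = (proj (b z j) - scal j *\<^sub>R z) /\<^sub>R scal j"
      using scal(1)[of j] by (simp add: P_def scaleR_diff_right)
    then have "dist (P z j) z = dist (proj (b z j)) (scal j *\<^sub>R z) / scal j"
      using scal(1)[of j] by (simp add: dist_norm divide_inverse)
    ultimately show ?case using scal(1)[of j] by (simp add: divide_le_eq)
  qed
  have "\<exists>l. (P z \<longlongrightarrow> l) \<omega>" for z
  proof (rule ultra_limit_bounded[OF \<omega>])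
    show "eventually (\<lambda>j. norm (P z j) \<le> 2 * C + norm z) \<omega>"
      using Pnear[of z]
    proof eventually_elim
      case (elim j)
      then show ?case using norm_triangle_ineq[of "P z j - z" z] by (simp add: dist_norm)
    qed
  qed
  then obtain \<Psi> where \<Psi>: "\<And>z. (P z \<longlongrightarrow> \<Psi> z) \<omega>" by metis
  define K where "K = 9 * \<Lambda>\<^sup>2 * R / (c * \<epsilon>)"
  show False
  proof (rule no_thin_map[of \<Psi> \<Lambda> "2 * C" K 1])
    show "dist (\<Psi> x) (\<Psi> y) \<le> \<Lambda> * dist x y" for x y
    proof (rule field_le_epsilon)
      fix \<delta> :: real assume \<delta>: "0 < \<delta>"
      have "eventually (\<lambda>j. dist (P x j) (P y j) \<le> \<Lambda> * dist x y + \<delta>) \<omega>"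
        using lip[OF \<delta>, of x y]
      proof eventually_elim
        case (elim j)
        then have "dist (proj (b x j)) (proj (b y j)) \<le> (\<Lambda> * dist x y + \<delta>) * scal j"
          using proj_lipschitz[OF b b] by (rule order_trans[rotated])
        then show ?case using scal(1)[of j] by (simp add: Pdist divide_le_eq)
      qed
      then show "dist (\<Psi> x) (\<Psi> y) \<le> \<Lambda> * dist x y + \<delta>"
        using tendsto_le[OF nb tendsto_const tendsto_dist[OF \<Psi> \<Psi>]] by blast
    qed
    show "dist (\<Psi> x) x \<le> 2 * C" for x
      using tendsto_le[OF nb tendsto_const tendsto_dist[OF \<Psi> tendsto_const] Pnear] .
    fix z r \<rho> T b0
    assume r: "0 < r" "r < (1::real)" and \<rho>: "0 < \<rho>" and T: "finite T" "T \<subseteq> cball z r"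
      and hull: "cball b0 \<rho> \<subseteq> convex hull (\<Psi> ` T)"
    have "T \<noteq> {}"
    proof
      assume "T = {}"
      then have "cball b0 \<rho> = {}" using hull by simp
      then show False using \<rho> by simp
    qed
    then obtain t0 where t0: "t0 \<in> T" by blast
    have "eventually (\<lambda>j. \<forall>t\<in>T. dist (P t j) (\<Psi> t) \<le> \<rho> / 2 \<and> d (b t0 j) (b t j) \<le> 3 * \<Lambda> * r * scal j) \<omega>"
    proof (intro eventually_ball_finite[OF T(1)] ballI eventually_conj)
      fix t assume t: "t \<in> T"
      have "eventually (\<lambda>j. dist (P t j) (\<Psi> t) < \<rho> / 2) \<omega>" using \<Psi> \<rho> by (intro tendstoD) auto
      then show "eventually (\<lambda>j. dist (P t j) (\<Psi> t) \<le> \<rho> / 2) \<omega>" by eventually_elim simp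
      have "dist t0 t \<le> 2 * r"
        using subsetD[OF T(2) t] subsetD[OF T(2) t0] dist_triangle[of t0 t z] by (simp add: dist_commute)
      then have "\<Lambda> * dist t0 t + \<Lambda> * r \<le> 3 * \<Lambda> * r" using pos(1) by (simp add: algebra_simps)
      then have "(\<Lambda> * dist t0 t + \<Lambda> * r) * scal j \<le> 3 * \<Lambda> * r * scal j" for j
        using scal(1)[of j] by (intro mult_right_mono) auto
      moreover have "eventually (\<lambda>j. d (b t0 j) (b t j) \<le> (\<Lambda> * dist t0 t + \<Lambda> * r) * scal j) \<omega>"
        using pos(1) r by (intro lip) simp
      ultimately show "eventually (\<lambda>j. d (b t0 j) (b t j) \<le> 3 * \<Lambda> * r * scal j) \<omega>"
        by (auto elim!: eventually_mono intro: order_trans)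
    qed
    \<comment> \<open>The bound on \<open>scal j\<close> makes \<open>N \<le> D\<close> and \<open>\<epsilon> \<le> \<delta>\<close> for the \<open>D\<close> and \<open>\<delta>\<close> introduced below.\<close>
    moreover have "eventually (\<lambda>j. max (N / c) (\<epsilon> / (9 * \<Lambda>\<^sup>2 * r\<^sup>2 / (2 * c))) \<le> scal j) \<omega>"
      using scal(2) by (simp only: filterlim_at_top)
    ultimately have "eventually (\<lambda>j. (\<forall>t\<in>T. dist (P t j) (\<Psi> t) \<le> \<rho> / 2 \<and> d (b t0 j) (b t j) \<le> 3 * \<Lambda> * r * scal j)
        \<and> max (N / c) (\<epsilon> / (9 * \<Lambda>\<^sup>2 * r\<^sup>2 / (2 * c))) \<le> scal j \<and> (\<forall>w. c * scal j \<le> d (b t0 j) (e w))) \<omega>"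
      using away[of t0] by (simp only: eventually_conj_iff)
    then obtain j where j: "\<And>t. t \<in> T \<Longrightarrow> dist (P t j) (\<Psi> t) \<le> \<rho> / 2"
        "\<And>t. t \<in> T \<Longrightarrow> d (b t0 j) (b t j) \<le> 3 * \<Lambda> * r * scal j"
        "max (N / c) (\<epsilon> / (9 * \<Lambda>\<^sup>2 * r\<^sup>2 / (2 * c))) \<le> scal j" "\<And>w. c * scal j \<le> d (b t0 j) (e w)"
      using eventually_happens'[OF nb] by blast
    define q D l where "q = b t0 j" and "D = d q (e (proj q))" and "l = scal j"
    \<comment> \<open>Chosen such that \<open>(3 * \<Lambda> * r * l)\<^sup>2 = 2 * (c * l) * \<delta>\<close>, which is at most \<open>2 * D * \<delta>\<close>.\<close>
    define \<delta> where "\<delta> = 9 * \<Lambda>\<^sup>2 * r\<^sup>2 / (2 * c) * l"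
    have q: "q \<in> X" by (simp add: q_def b)
    have l: "0 < l" by (simp add: l_def scal)
    have cD: "c * l \<le> D" using j(4) by (simp add: D_def q_def l_def)
    have k0: "0 < 9 * \<Lambda>\<^sup>2 * r\<^sup>2 / (2 * c)" using pos r by simp
    have "N \<le> c * l" using j(3) pos by (simp add: l_def divide_le_eq mult.commute)
    then have ND: "N \<le> D" using cD by simp
    have "\<epsilon> / (9 * \<Lambda>\<^sup>2 * r\<^sup>2 / (2 * c)) \<le> l" using j(3) by (simp add: l_def)
    then have \<epsilon>\<delta>: "\<epsilon> \<le> \<delta>" using k0 unfolding \<delta>_def by (simp only: divide_le_eq mult.commute)
    have mem: "proj (b t j) \<in> sublevel q \<delta>" if t: "t \<in> T" for t
    proof -
      have "(d q (e (proj (b t j))))\<^sup>2 \<le> D\<^sup>2 + (d q (b t j))\<^sup>2"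
        unfolding D_def by (rule proj_of_nearby[OF q b])
      also have "(d q (b t j))\<^sup>2 \<le> (3 * \<Lambda> * r * l)\<^sup>2"
        using j(2)[OF t] by (intro power_mono) (auto simp: q_def l_def)
      also have "(3 * \<Lambda> * r * l)\<^sup>2 = 2 * (c * l) * \<delta>"
        using pos by (simp add: \<delta>_def power2_eq_square)
      also have "2 * (c * l) * \<delta> \<le> 2 * D * \<delta>"
        using cD \<epsilon> \<epsilon>\<delta> by (intro mult_right_mono) auto
      also have "D\<^sup>2 + 2 * D * \<delta> \<le> (D + \<delta>)\<^sup>2" by (simp add: power2_eq_square algebra_simps)
      finally have "d q (e (proj (b t j))) \<le> D + \<delta>"
        using \<epsilon> \<epsilon>\<delta> by (auto intro: power2_le_imp_le simp: D_def)
      then show ?thesis by (simp add: sublevel_def D_def)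
    qed
    have half: "cball b0 (\<rho> / 2) \<subseteq> convex hull ((\<lambda>t. P t j) ` T)"
      using cball_subset_hull_perturb[OF T(1) hull, of "\<lambda>t. P t j" "\<rho> / 2"] j(1) \<rho> by simp
    have big: "cball (l *\<^sub>R b0) (l * \<rho> / 2) \<subseteq> sublevel q \<delta>"
    proof
      fix y assume y: "y \<in> cball (l *\<^sub>R b0) (l * \<rho> / 2)"
      have "b0 - y /\<^sub>R l = (l *\<^sub>R b0 - y) /\<^sub>R l" using l by (simp add: scaleR_diff_right)
      then have "dist b0 (y /\<^sub>R l) = dist (l *\<^sub>R b0) y / l" using l by (simp add: dist_norm divide_inverse)
      also have "\<dots> \<le> \<rho> / 2" using y l by (simp add: divide_le_eq mult.commute)
      finally have "y /\<^sub>R l \<in> convex hull ((\<lambda>t. P t j) ` T)" using half by auto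
      then have "l *\<^sub>R (y /\<^sub>R l) \<in> convex hull ((*\<^sub>R) l ` (\<lambda>t. P t j) ` T)"
        unfolding convex_hull_scaling by (rule imageI)
      moreover have "(*\<^sub>R) l ` (\<lambda>t. P t j) ` T = (\<lambda>t. proj (b t j)) ` T"
        using l by (simp add: image_image P_def l_def)
      moreover have "convex hull ((\<lambda>t. proj (b t j)) ` T) \<subseteq> sublevel q \<delta>"
        using mem by (intro hull_minimal convex_sublevel[OF q]) auto
      ultimately show "y \<in> sublevel q \<delta>" using l by auto
    qed
    show "\<rho> \<le> K * r\<^sup>2"
    proof (rule ccontr)
      assume "\<not> ?thesis"
      then have "K * r\<^sup>2 * (l * \<epsilon> / 2) \<le> \<rho> * (l * \<epsilon> / 2)" using l \<epsilon> by (intro mult_right_mono) auto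
      moreover have "K * r\<^sup>2 * (l * \<epsilon> / 2) = R * \<delta>"
        using pos \<epsilon> by (simp add: K_def \<delta>_def field_simps)
      ultimately have "R * \<delta> \<le> (l * \<rho> / 2) * \<epsilon>" by (simp add: algebra_simps)
      then have "\<exists>b'. cball b' R \<subseteq> sublevel q \<epsilon>" by (rule sublevel_shrink[OF q \<epsilon> \<epsilon>\<delta> big])
      then show False using no q ND unfolding D_def by blast
    qed
  qed (use pos R \<epsilon> in \<open>auto simp: K_def\<close>)
qed

end

section \<open>Cocompact flats\<close>

lemma stabD:
  assumes "g \<in> stab M \<eta>"
  shows "isometric_embedding M M g" "g ` \<eta> = \<eta>"
  using assms by (auto simp: stab_def stabilizer_def isometry_group_def)

text \<open>The orbits that meet the ball of radius \<open>n\<close> around \<open>e 0\<close> form an open subset of the orbit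
  space, and these subsets exhaust it.\<close>

lemma (in flat_in_cat0) cocompact_stab:
  assumes cpt: "compact_space (flat_quotient M (range e))"
  shows "\<exists>\<rho>. \<forall>x. \<exists>g\<in>stab M (range e). d (g (e x)) (e 0) < \<rho>"
proof -
  interpret MS: Metric_space "mspace M" "mdist M" by simp
  let ?T = "subtopology (mtopology_of M) (range e)"
  let ?q = "orbit ((isometry_group M)\<lparr>carrier := stab M (range e)\<rparr>) (\<lambda>g. g)"
  have X: "topspace ?T = range e" by (auto simp: e_in)
  have topq: "topspace (flat_quotient M (range e)) = ?q ` range e"
    by (simp only: flat_quotient_def topspace_quotient_topology X)
  define U where "U n = {Q \<in> ?q ` range e. \<exists>y\<in>Q. d y (e 0) < real n}" for n
  have orb: "?q x = {g x |g. g \<in> stab M (range e)}" for x by (simp add: orbit_def)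
  have "openin (flat_quotient M (range e)) (U n)" for n
  proof -
    have "{x \<in> range e. ?q x \<in> U n} = (\<Union>g\<in>stab M (range e). {x \<in> range e. d (g x) (e 0) < n})"
      by (auto simp: U_def orb)
    moreover have "openin ?T {x \<in> range e. d (g x) (e 0) < n}" if g: "g \<in> stab M (range e)" for g
    proof -
      have gX: "g x \<in> X" if "x \<in> X" for x
        using stabD(1)[OF g] that by (auto simp: isometric_embedding_def)
      have gd: "d (g x) (g y) = d x y" if "x \<in> X" "y \<in> X" for x y
        using stabD(1)[OF g] that by (auto simp: isometric_embedding_def)
      have "openin MS.mtopology {x \<in> X. d (g x) (e 0) < n}"
        unfolding MS.openin_mtopology
      proof (intro conjI allI impI)
        fix x assume x: "x \<in> {x \<in> X. d (g x) (e 0) < n}"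
        show "\<exists>r>0. MS.mball x r \<subseteq> {x \<in> X. d (g x) (e 0) < n}"
        proof (intro exI conjI)
          show "0 < n - d (g x) (e 0)" using x by simp
          show "MS.mball x (n - d (g x) (e 0)) \<subseteq> {x \<in> X. d (g x) (e 0) < n}"
          proof
            fix y assume "y \<in> MS.mball x (n - d (g x) (e 0))"
            then have y: "x \<in> X" "y \<in> X" "d x y < n - d (g x) (e 0)" by auto
            then show "y \<in> {x \<in> X. d (g x) (e 0) < n}"
              using mdist_triangle[of "g y" M "g x" "e 0"] gX[of y] gX[of x] gd[of y x]
              by (simp add: mdist_commute[of M y])
          qed
        qed
      qed auto
      then have "openin ?T (range e \<inter> {x \<in> X. d (g x) (e 0) < n})"
        by (simp add: mtopology_of_def openin_subtopology_Int2)
      moreover have "range e \<inter> {x \<in> X. d (g x) (e 0) < n} = {x \<in> range e. d (g x) (e 0) < n}" by auto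
      ultimately show ?thesis by simp
    qed
    ultimately have "openin ?T {x \<in> range e. ?q x \<in> U n}" by auto
    then show ?thesis unfolding flat_quotient_def openin_quotient_topology X by (auto simp: U_def)
  qed
  moreover have "topspace (flat_quotient M (range e)) \<subseteq> \<Union>(range U)"
  proof
    fix Q assume "Q \<in> topspace (flat_quotient M (range e))"
    then have Q: "Q \<in> ?q ` range e" by (simp only: topq)
    have "(\<lambda>x\<in>X. x) \<in> stab M (range e)"
      by (auto simp: stab_def stabilizer_def isometry_group_def isometric_embedding_def id_Bij image_iff)
    then obtain y where "y \<in> Q" using Q by (auto simp: orb)
    moreover obtain n :: nat where "d y (e 0) < n" using reals_Archimedean2 by blast
    ultimately show "Q \<in> \<Union>(range U)" using Q by (auto simp: U_def)
  qed
  ultimately obtain F where F: "finite F" "F \<subseteq> range U" "topspace (flat_quotient M (range e)) \<subseteq> \<Union>F"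
    using cpt unfolding compact_space_def compactin_def by (metis (no_types, lifting) imageE)
  obtain I where I: "finite I" "F = U ` I" using F(1,2) by (meson finite_subset_image)
  have "\<exists>g\<in>stab M (range e). d (g (e x)) (e 0) < real (Max (insert 0 I)) + 1" for x
  proof -
    have "?q (e x) \<in> \<Union>F" using F(3) unfolding topq by blast
    then obtain n where n: "n \<in> I" "?q (e x) \<in> U n" using I(2) by auto
    then obtain g where "g \<in> stab M (range e)" "d (g (e x)) (e 0) < n" by (auto simp: U_def orb)
    moreover have "n \<le> Max (insert 0 I)" using n I by simp
    ultimately show ?thesis by force
  qed
  then show ?thesis by blast
qed

text \<open>Isometries that stabilise the flat bring the centres of ever larger balls in sublevel sets
  back to a bounded region, so that the balls eventually contain every point of the flat.\<close>

lemma (in flat_in_cat0) far_points_of_cocompact: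
  assumes coc: "\<And>x. \<exists>g\<in>stab M (range e). d (g (e x)) (e 0) < \<rho>"
    and thick: "\<And>R \<epsilon> N. 0 < R \<Longrightarrow> 0 < \<epsilon> \<Longrightarrow>
      \<exists>q\<in>X. N \<le> d q (e (proj q)) \<and> (\<exists>b'. cball b' R \<subseteq> sublevel q \<epsilon>)"
  shows "\<exists>q. (\<forall>n. q n \<in> X) \<and> filterlim (\<lambda>n. d (q n) (e 0)) at_top sequentially \<and>
    (\<forall>x. (\<lambda>n. d (q n) (e x) - d (q n) (e 0)) \<longlonglongrightarrow> 0)"
proof -
  have "\<exists>q\<in>X. real n \<le> d q (e 0) \<and> (\<forall>x. norm x + \<rho> \<le> n \<longrightarrow> \<bar>d q (e x) - d q (e 0)\<bar> \<le> 1 / real (Suc n))"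
    if n: "\<rho> \<le> n" for n :: nat
  proof -
    obtain q b where q: "q \<in> X" and D: "real n \<le> d q (e (proj q))"
      and b: "cball b (real n + 1) \<subseteq> sublevel q (1 / Suc n)"
      using thick[of "real n + 1" "1 / Suc n" n] by auto
    obtain g where g: "g \<in> stab M (range e)" "d (g (e b)) (e 0) < \<rho>" using coc by blast
    have gX: "g x \<in> X" if "x \<in> X" for x
      using stabD(1)[OF g(1)] that by (auto simp: isometric_embedding_def)
    have gd: "d (g x) (g y) = d x y" if "x \<in> X" "y \<in> X" for x y
      using stabD(1)[OF g(1)] that by (auto simp: isometric_embedding_def)
    have bnd: "d q (e (proj q)) \<le> d (g q) (e x) \<and> d (g q) (e x) \<le> d q (e (proj q)) + 1 / Suc n"
      if x: "norm x + \<rho> \<le> n" for x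
    proof -
      have "e x \<in> g ` range e" using stabD(2)[OF g(1)] by auto
      then obtain y where y: "e x = g (e y)" by auto
      have "dist b y = d (g (e b)) (e x)" using gd[of "e b" "e y"] y by simp
      also have "\<dots> \<le> d (g (e b)) (e 0) + d (e 0) (e x)" using gX by (intro mdist_triangle) auto
      finally have "y \<in> cball b (real n + 1)" using g(2) x by simp
      then have "d q (e y) \<le> d q (e (proj q)) + 1 / Suc n" using b by (auto simp: sublevel_def)
      moreover have "d (g q) (e x) = d q (e y)" using gd[OF q, of "e y"] y by simp
      ultimately show ?thesis using proj_le[OF q, of y] by simp
    qed
    have 0: "d q (e (proj q)) \<le> d (g q) (e 0)" "d (g q) (e 0) \<le> d q (e (proj q)) + 1 / Suc n"
      using bnd[of 0] n by simp_all
    show ?thesis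
    proof (intro bexI[of _ "g q"] conjI allI impI)
      show "real n \<le> d (g q) (e 0)" using D 0 by simp
      fix x :: "real^'k" assume "norm x + \<rho> \<le> n"
      then show "\<bar>d (g q) (e x) - d (g q) (e 0)\<bar> \<le> 1 / real (Suc n)" using bnd[of x] 0 by linarith
    qed (use gX q in blast)
  qed
  then have "\<forall>n::nat. \<exists>q\<in>X. \<rho> \<le> n \<longrightarrow> real n \<le> d q (e 0) \<and>
      (\<forall>x. norm x + \<rho> \<le> n \<longrightarrow> \<bar>d q (e x) - d q (e 0)\<bar> \<le> 1 / real (Suc n))"
    using e_in by (metis (no_types, lifting))
  then obtain q where q: "\<And>n. q n \<in> X" and q1: "\<And>n. \<rho> \<le> n \<Longrightarrow> real n \<le> d (q n) (e 0)"
    and q2: "\<And>n x. \<rho> \<le> real n \<Longrightarrow> norm x + \<rho> \<le> n \<Longrightarrow> \<bar>d (q n) (e x) - d (q n) (e 0)\<bar> \<le> 1 / real (Suc n)"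
    by metis
  have "filterlim (\<lambda>n. d (q n) (e 0)) at_top sequentially"
  proof (rule filterlim_at_top_mono[OF filterlim_real_sequentially])
    show "eventually (\<lambda>n. real n \<le> d (q n) (e 0)) sequentially"
      using eventually_ge_at_top[of "nat \<lceil>\<rho>\<rceil>"] by eventually_elim (use q1 in \<open>auto simp: nat_le_iff ceiling_le_iff\<close>)
  qed
  moreover have "(\<lambda>n. d (q n) (e x) - d (q n) (e 0)) \<longlonglongrightarrow> 0" for x
  proof (rule Lim_null_comparison[OF _ LIMSEQ_inverse_real_of_nat])
    show "eventually (\<lambda>n. norm (d (q n) (e x) - d (q n) (e 0)) \<le> inverse (real (Suc n))) sequentially"
      using eventually_ge_at_top[of "nat \<lceil>norm x + \<rho>\<rceil>"]
    proof eventually_elim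
      case (elim n)
      then have "norm x + \<rho> \<le> n" by (simp add: nat_le_iff ceiling_le_iff)
      moreover from this have "\<rho> \<le> n" using norm_ge_zero[of x] by linarith
      ultimately show ?case using q2[of n x] by (simp add: inverse_eq_divide)
    qed
  qed
  ultimately show ?thesis using q by blast
qed

section \<open>From the asymptotic cone to the second space\<close>

lemma nonprincipal_ultra: "nonprincipal_ultrafilter \<omega> \<Longrightarrow> ultrafilter \<omega>"
  by (simp add: nonprincipal_ultrafilter_def ultrafilter_def)

lemma nonprincipal_le_sequentially:
  assumes "nonprincipal_ultrafilter \<omega>" shows "\<omega> \<le> sequentially"
  unfolding le_sequentially
proof
  fix N
  have "eventually (\<lambda>j. j \<noteq> i) \<omega>" for i
    using assms unfolding nonprincipal_ultrafilter_def by blast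
  then have "eventually (\<lambda>j. \<forall>i\<in>{..<N}. j \<noteq> i) \<omega>" by (intro eventually_ball_finite) auto
  then show "eventually (\<lambda>n. N \<le> n) \<omega>" by eventually_elim (metis leI lessThan_iff)
qed

lemma hausdorff_finiteD:
  assumes "hausdorff_distance m S T < \<infinity>"
  shows "\<exists>B. (\<forall>x\<in>S. \<exists>y\<in>T. mdist m x y \<le> B) \<and> (\<forall>y\<in>T. \<exists>x\<in>S. mdist m x y \<le> B)"
proof -
  define H where "H = hausdorff_distance m S T"
  obtain h where h: "0 \<le> h" "H = ennreal h" using assms by (cases H) (auto simp: H_def)
  have lt: "H < ennreal (h + 1)" using h by (simp add: ennreal_less_iff)
  have "\<exists>y\<in>T. mdist m x y \<le> h + 1" if "x \<in> S" for x
  proof -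
    have "(INF y\<in>T. ennreal (mdist m x y)) \<le> H"
      unfolding H_def hausdorff_distance_def using that by (intro max.coboundedI1 SUP_upper)
    then have "(INF y\<in>T. ennreal (mdist m x y)) < ennreal (h + 1)" using lt by (rule le_less_trans)
    then show ?thesis unfolding INF_less_iff by (auto simp: ennreal_less_iff intro: less_imp_le)
  qed
  moreover have "\<exists>x\<in>S. mdist m x y \<le> h + 1" if "y \<in> T" for y
  proof -
    have "(INF x\<in>S. ennreal (mdist m x y)) \<le> H"
      unfolding H_def hausdorff_distance_def using that by (intro max.coboundedI2 SUP_upper)
    then have "(INF x\<in>S. ennreal (mdist m x y)) < ennreal (h + 1)" using lt by (rule le_less_trans)
    then show ?thesis unfolding INF_less_iff by (auto simp: ennreal_less_iff intro: less_imp_le)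
  qed
  ultimately show ?thesis by blast
qed

text \<open>The points \<open>b z j\<close> are the images under \<open>\<phi>\<close> of sequences representing the points at height
  \<open>1\<close> in the half-flat, above the boundary point represented by points of \<open>\<gamma>\<close> with \<open>\<phi>\<close>-images
  near \<open>e (scal j *\<^sub>R z)\<close>.\<close>

lemma half_flat_sequences:
  fixes M1 :: "'a metric" and M2 :: "'b metric" and e :: "real^'k::finite \<Rightarrow> 'b"
  assumes \<omega>: "nonprincipal_ultrafilter \<omega>" and scal: "\<And>j. 0 < scal j" "filterlim scal at_top \<omega>"
    and base: "base \<in> mspace M1"
    and qi: "quasi_isometric_map C K M1 M2 \<phi>" and C: "1 \<le> C" and K: "0 \<le> K"
    and \<gamma>: "\<gamma> \<subseteq> mspace M1"
    and F: "bilipschitz_half_flat_bounding TYPE('k) (asymptotic_cone \<omega> scal M1 base) F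
             (cone_subset \<omega> scal M1 base \<gamma>)"
    and e: "isometric_embedding euclidean_metric M2 e"
    and B: "\<And>x. \<exists>p\<in>\<gamma>. mdist M2 (e x) (\<phi> p) \<le> B"
  obtains b :: "real^'k \<Rightarrow> nat \<Rightarrow> 'b" and \<Lambda> C' c :: real
  where "\<And>z j. b z j \<in> mspace M2"
    "\<And>z z' \<delta>. 0 < \<delta> \<Longrightarrow> eventually (\<lambda>j. mdist M2 (b z j) (b z' j) \<le> (\<Lambda> * dist z z' + \<delta>) * scal j) \<omega>"
    "\<And>z. eventually (\<lambda>j. mdist M2 (b z j) (e (scal j *\<^sub>R z)) \<le> C' * scal j) \<omega>"
    "\<And>z. eventually (\<lambda>j. \<forall>w. c * scal j \<le> mdist M2 (b z j) (e w)) \<omega>"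
    "0 < \<Lambda>" "0 < C'" "0 < c"
proof -
  have ultrafilter: "ultrafilter \<omega>" by (rule nonprincipal_ultra[OF \<omega>])
  have nb: "\<omega> \<noteq> bot" using ultrafilter by (simp add: ultrafilter_def)
  define A where "A = asymptotic_cone \<omega> scal M1 base"
  define S where "S = cone_seqs \<omega> scal M1 base"
  define cl where "cl x = cone_rel \<omega> scal M1 base `` {x}" for x
  note cone = \<omega> scal(1) base
  have mA: "mspace A = S // cone_rel \<omega> scal M1 base"
    unfolding A_def S_def by (rule mspace_asymptotic_cone[OF cone])
  have clA: "cl x \<in> mspace A" if "x \<in> S" for x
    using that unfolding mA cl_def by (rule quotientI)
  have SX: "x j \<in> mspace M1" if "x \<in> S" for x j
    using that unfolding S_def cone_seqs_def by blast
  have lim: "((\<lambda>j. mdist M1 (x j) (y j) / scal j) \<longlongrightarrow> mdist A (cl x) (cl y)) \<omega>"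
    if "x \<in> S" "y \<in> S" for x y
  proof -
    have "((\<lambda>j. ennreal (mdist M1 (x j) (y j) / scal j)) \<longlongrightarrow> ennreal (mdist A (cl x) (cl y))) \<omega>"
      using seq_dist_tendsto[where scal = scal, OF cone, of x y]
        mdist_asymptotic_cone[where scal = scal, OF cone, of x y] that
      by (simp add: A_def cl_def S_def)
    then show ?thesis
      using scal(1) by (intro tendsto_ennrealD) (auto simp: less_imp_le)
  qed
  have e2 [simp]: "e x \<in> mspace M2" "mdist M2 (e x) (e y) = dist x y" for x y
    using e by (auto simp: isometric_embedding_def)
  have \<phi>2: "\<phi> x \<in> mspace M2" if "x \<in> mspace M1" for x
    using qi that by (auto simp: quasi_isometric_map_def)
  have up: "mdist M2 (\<phi> x) (\<phi> y) \<le> C * mdist M1 x y + K" if "x \<in> mspace M1" "y \<in> mspace M1" for x y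
    using qi that by (auto simp: quasi_isometric_map_def)
  have lo: "mdist M1 x y \<le> C * (mdist M2 (\<phi> x) (\<phi> y) + K)" if "x \<in> mspace M1" "y \<in> mspace M1" for x y
  proof -
    have "1 / C * mdist M1 x y - K \<le> mdist M2 (\<phi> x) (\<phi> y)"
      using qi that by (auto simp: quasi_isometric_map_def)
    then show ?thesis using C by (simp add: field_simps)
  qed
  have small: "((\<lambda>j. k / scal j) \<longlongrightarrow> 0) \<omega>" for k
    by (rule real_tendsto_divide_at_top[OF tendsto_const scal(2)])
  have ge: "eventually (\<lambda>j. k \<le> scal j) \<omega>" for k
    using scal(2) by (simp add: filterlim_at_top)
  obtain h :: "(real^'k) \<times> real \<Rightarrow> (nat \<Rightarrow> 'a) set" where
    h: "bilipschitz_embedding half_space A h" and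
    homeo: "homeomorphic_map (top_of_set (UNIV \<times> {0})) (subtopology (mtopology_of A) (cone_subset \<omega> scal M1 base \<gamma>)) h"
    using F unfolding bilipschitz_half_flat_bounding_def A_def by blast
  have hs: "mspace (half_space :: ((real^'k) \<times> real) metric) = UNIV \<times> {0..}"
     "mdist (half_space :: ((real^'k) \<times> real) metric) = dist"
    by (simp_all add: half_space_def)
  obtain L where L: "1 \<le> L" and bil: "\<And>x y. snd x \<ge> 0 \<Longrightarrow> snd y \<ge> 0 \<Longrightarrow>
      dist x y / L \<le> mdist A (h x) (h y) \<and> mdist A (h x) (h y) \<le> L * dist x y"
    using h unfolding bilipschitz_embedding_def hs by (auto simp: mem_Times_iff)
  have hA: "h x \<in> mspace A" if "snd x \<ge> 0" for x
    using h that unfolding bilipschitz_embedding_def hs by (auto simp: mem_Times_iff)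
  have himg: "h ` (UNIV \<times> {0}) = cone_subset \<omega> scal M1 base \<gamma>"
    using homeomorphic_imp_surjective_map[OF homeo] by (auto simp: cone_subset_def A_def)
  define a where "a x = (SOME u. u \<in> S \<and> h (x, 1) = cl u)" for x
  have a: "a x \<in> S" "h (x, 1) = cl (a x)" for x
  proof -
    have "\<exists>u. u \<in> S \<and> h (x, 1) = cl u"
      using hA[of "(x, 1)"] unfolding mA cl_def by (auto elim!: quotientE)
    from someI_ex[OF this] show "a x \<in> S" "h (x, 1) = cl (a x)" unfolding a_def by blast+
  qed
  \<comment> \<open>Sequences in \<open>\<gamma>\<close> that track a sequence in the flat of \<open>e\<close> growing linearly with \<open>scal\<close> represent
    points of the limit flat of \<open>\<gamma>\<close>, which is the boundary of the half-flat.\<close>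
  have boundary: "u \<in> S \<and> (\<exists>x. h (x, 0) = cl u)"
    if u: "\<And>j. u j \<in> \<gamma>" and uw: "eventually (\<lambda>j. mdist M2 (e (w j)) (\<phi> (u j)) \<le> B) \<omega>"
      and w: "eventually (\<lambda>j. norm (w j) \<le> W * scal j) \<omega>" for u w W
  proof -
    define k where "k = B + mdist M2 (e 0) (\<phi> base) + K"
    have uX: "u j \<in> mspace M1" for j using u \<gamma> by blast
    have "eventually (\<lambda>j. mdist M1 (u j) base / scal j \<le> C * (W + 1)) \<omega>"
      using uw w ge[of k]
    proof eventually_elim
      case (elim j)
      have "mdist M2 (\<phi> (u j)) (\<phi> base) \<le> mdist M2 (\<phi> (u j)) (e (w j)) + (dist (w j) 0 + mdist M2 (e 0) (\<phi> base))"
        using mdist_triangle[of "\<phi> (u j)" M2 "e (w j)" "\<phi> base"] mdist_triangle[of "e (w j)" M2 "e 0" "\<phi> base"]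
          \<phi>2[OF uX] \<phi>2[OF base] by simp
      then have "mdist M2 (\<phi> (u j)) (\<phi> base) + K \<le> (W + 1) * scal j"
        using elim by (simp add: k_def mdist_commute[of M2 "\<phi> (u j)"] algebra_simps)
      then have "C * (mdist M2 (\<phi> (u j)) (\<phi> base) + K) \<le> C * ((W + 1) * scal j)"
        using C by (intro mult_left_mono) auto
      then have "mdist M1 (u j) base \<le> C * (W + 1) * scal j"
        using lo[OF uX base, of j] by (simp add: mult.assoc)
      then show ?case using scal(1)[of j] by (simp add: divide_le_eq)
    qed
    then have "eventually (\<lambda>j. ennreal (mdist M1 (u j) base / scal j) \<le> ennreal (C * (W + 1))) \<omega>"
      by eventually_elim (rule ennreal_leI)
    then have "seq_dist \<omega> scal M1 u (\<lambda>_. base) \<le> ennreal (C * (W + 1))"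
      by (rule tendsto_upperbound[OF seq_dist_tendsto[where scal = scal, OF cone] _ nb])
    then have "seq_dist \<omega> scal M1 u (\<lambda>_. base) < \<infinity>" by (rule le_less_trans) simp
    then have uS: "u \<in> S" using uX by (simp add: S_def cone_seqs_def)
    have "u \<in> cl u" unfolding cl_def
      by (rule equiv_class_self[OF equiv_cone_rel[where scal = scal, OF cone]]) (use uS in \<open>simp add: S_def\<close>)
    then have "cl u \<in> cone_subset \<omega> scal M1 base \<gamma>"
      using clA[OF uS] u unfolding cone_subset_def A_def by blast
    then have "cl u \<in> h ` (UNIV \<times> {0})" by (simp only: himg)
    then obtain x where "cl u = h (x, 0)" by (elim imageE SigmaE) simp
    then show ?thesis using uS by (intro conjI exI[of _ x]) simp_all
  qed
  have "\<exists>near. \<forall>x. near x \<in> \<gamma> \<and> mdist M2 (e x) (\<phi> (near x)) \<le> B"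
    using B by (intro choice allI) blast
  then obtain near where near: "\<And>x. near x \<in> \<gamma>" "\<And>x. mdist M2 (e x) (\<phi> (near x)) \<le> B" by blast
  define u where "u z j = near (scal j *\<^sub>R z)" for z :: "real^'k" and j
  have u: "u z \<in> S \<and> (\<exists>x. h (x, 0) = cl (u z))" for z
  proof (rule boundary)
    show "u z j \<in> \<gamma>" for j by (simp add: u_def near)
    show "eventually (\<lambda>j. mdist M2 (e (scal j *\<^sub>R z)) (\<phi> (u z j)) \<le> B) \<omega>" by (simp add: u_def near)
    show "eventually (\<lambda>j. norm (scal j *\<^sub>R z) \<le> norm z * scal j) \<omega>"
      using scal(1) by (simp add: less_imp_le mult.commute)
  qed
  then obtain G where G: "\<And>z. h (G z, 0) = cl (u z)" by metis
  define b where "b z j = \<phi> (a (G z) j)" for z j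
  have aX: "a x j \<in> mspace M1" for x j using SX[OF a(1)] .
  have uX: "u z j \<in> mspace M1" for z j using SX u by blast
  have bX: "b z j \<in> mspace M2" for z j by (simp add: b_def \<phi>2 aX)
  have Glip: "dist (G z) (G z') \<le> L * (C * dist z z')" for z z'
  proof -
    have "dist (G z) (G z') / L \<le> mdist A (cl (u z)) (cl (u z'))"
      using bil[of "(G z, 0)" "(G z', 0)"] by (simp add: G dist_Pair_Pair)
    also have "\<dots> \<le> C * dist z z' + C * 0"
    proof (rule tendsto_le[OF nb _ lim])
      show "((\<lambda>j. C * dist z z' + C * ((2 * B + K) / scal j)) \<longlongrightarrow> C * dist z z' + C * 0) \<omega>"
        by (intro tendsto_intros small)
      show "eventually (\<lambda>j. mdist M1 (u z j) (u z' j) / scal j \<le> C * dist z z' + C * ((2 * B + K) / scal j)) \<omega>"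
      proof (intro always_eventually allI)
        fix j
        let ?e = "e (scal j *\<^sub>R z)" and ?e' = "e (scal j *\<^sub>R z')"
        have "mdist M2 (\<phi> (u z j)) (\<phi> (u z' j)) \<le> mdist M2 (\<phi> (u z j)) ?e + (mdist M2 ?e ?e' + mdist M2 ?e' (\<phi> (u z' j)))"
          using mdist_triangle[of "\<phi> (u z j)" M2 ?e "\<phi> (u z' j)"] mdist_triangle[of ?e M2 ?e' "\<phi> (u z' j)"]
            \<phi>2[OF uX] by simp
        moreover have "mdist M2 (\<phi> (u z j)) ?e \<le> B" "mdist M2 ?e' (\<phi> (u z' j)) \<le> B"
          using near(2) by (simp_all add: u_def mdist_commute[of M2 _ ?e])
        moreover have "mdist M2 ?e ?e' = scal j * dist z z'"
          using scal(1)[of j] by (simp add: dist_norm flip: scaleR_diff_right)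
        ultimately have "mdist M2 (\<phi> (u z j)) (\<phi> (u z' j)) + K \<le> scal j * dist z z' + (2 * B + K)" by simp
        then have "C * (mdist M2 (\<phi> (u z j)) (\<phi> (u z' j)) + K) \<le> C * (scal j * dist z z' + (2 * B + K))"
          using C by (intro mult_left_mono) auto
        then have "mdist M1 (u z j) (u z' j) \<le> C * (scal j * dist z z' + (2 * B + K))"
          using lo[OF uX uX] by (rule order_trans[rotated])
        also have "\<dots> = (C * dist z z' + C * ((2 * B + K) / scal j)) * scal j"
          using scal(1)[of j] by (simp add: field_simps)
        finally show "mdist M1 (u z j) (u z' j) / scal j \<le> C * dist z z' + C * ((2 * B + K) / scal j)"
          using scal(1)[of j] by (simp add: divide_le_eq)
      qed
    qed (use u in blast)+
    finally show ?thesis using L by (simp add: divide_le_eq mult.commute)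
  qed
  have ev_le: "eventually (\<lambda>j. C * mdist M1 (x j) (y j) + k \<le> (C * l + \<delta>) * scal j) \<omega>"
    if xy: "x \<in> S" "y \<in> S" and l: "mdist A (cl x) (cl y) \<le> l" and \<delta>: "0 < \<delta>" for x y k l \<delta>
  proof -
    have "((\<lambda>j. C * (mdist M1 (x j) (y j) / scal j) + k / scal j) \<longlongrightarrow> C * mdist A (cl x) (cl y) + 0) \<omega>"
      by (intro tendsto_intros lim xy small)
    moreover have "C * mdist A (cl x) (cl y) + 0 < C * l + \<delta>"
      using mult_left_mono[OF l, of C] C \<delta> by linarith
    ultimately have "eventually (\<lambda>j. C * (mdist M1 (x j) (y j) / scal j) + k / scal j < C * l + \<delta>) \<omega>"
      by (rule order_tendstoD(2))
    then show ?thesis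
    proof eventually_elim
      case (elim j)
      have "C * mdist M1 (x j) (y j) + k = (C * (mdist M1 (x j) (y j) / scal j) + k / scal j) * scal j"
        using scal(1)[of j] by (simp add: algebra_simps)
      also have "\<dots> \<le> (C * l + \<delta>) * scal j"
        using elim scal(1)[of j] by (intro mult_right_mono) auto
      finally show ?case .
    qed
  qed
  have P1: "eventually (\<lambda>j. mdist M2 (b z j) (b z' j) \<le> (C * (L * (L * C)) * dist z z' + \<delta>) * scal j) \<omega>"
    if \<delta>: "0 < \<delta>" for z z' \<delta>
  proof -
    have "mdist A (cl (a (G z))) (cl (a (G z'))) \<le> L * dist (G z) (G z')"
      using bil[of "(G z, 1)" "(G z', 1)"] by (simp add: a dist_Pair_Pair)
    also have "\<dots> \<le> L * (L * (C * dist z z'))" using Glip L by (intro mult_left_mono) auto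
    finally have "eventually (\<lambda>j. C * mdist M1 (a (G z) j) (a (G z') j) + K \<le> (C * (L * (L * (C * dist z z'))) + \<delta>) * scal j) \<omega>"
      by (intro ev_le a \<delta>)
    then show ?thesis
    proof eventually_elim
      case (elim j)
      then show ?case using up[OF aX aX, of "G z" j "G z'" j] by (simp add: b_def mult.assoc)
    qed
  qed
  have P2: "eventually (\<lambda>j. mdist M2 (b z j) (e (scal j *\<^sub>R z)) \<le> (C * L + 1) * scal j) \<omega>" for z
  proof -
    have "mdist A (cl (a (G z))) (cl (u z)) \<le> L"
      using bil[of "(G z, 1)" "(G z, 0)"] by (simp add: a G dist_Pair_Pair)
    then have "eventually (\<lambda>j. C * mdist M1 (a (G z) j) (u z j) + (K + B) \<le> (C * L + 1) * scal j) \<omega>"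
      using u by (intro ev_le a) auto
    then show ?thesis
    proof eventually_elim
      case (elim j)
      have "mdist M2 (\<phi> (u z j)) (e (scal j *\<^sub>R z)) \<le> B"
        using near(2) by (simp add: u_def mdist_commute[of M2 _ "e (scal j *\<^sub>R z)"])
      then show ?case
        using mdist_triangle[of "b z j" M2 "\<phi> (u z j)" "e (scal j *\<^sub>R z)"] bX \<phi>2[OF uX, of z j]
          up[OF aX uX, of "G z" j z j] elim by (simp add: b_def)
    qed
  qed
  \<comment> \<open>Points at height \<open>1\<close> have distance at least \<open>1 / L\<close> from the boundary, and \<open>\<phi>\<close> contracts by at most
    a factor \<open>C\<close> asymptotically; the factor \<open>2\<close> leaves room for a strict inequality.\<close>
  define c where "c = 1 / (2 * C * L)"
  have c: "0 < c" using C L by (simp add: c_def)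
  have P3: "eventually (\<lambda>j. \<forall>w. c * scal j \<le> mdist M2 (b z j) (e w)) \<omega>" for z
  proof (rule ccontr)
    assume "\<not> ?thesis"
    then have "eventually (\<lambda>j. \<not> (\<forall>w. c * scal j \<le> mdist M2 (b z j) (e w))) \<omega>"
      using ultrafilter unfolding ultrafilter_def by blast
    then have ev: "eventually (\<lambda>j. \<exists>w. mdist M2 (b z j) (e w) < c * scal j) \<omega>"
      by (simp add: not_le)
    define w where "w j = (SOME w. mdist M2 (b z j) (e w) < c * scal j)" for j
    have w: "eventually (\<lambda>j. mdist M2 (b z j) (e (w j)) < c * scal j) \<omega>"
      using ev unfolding w_def by eventually_elim (rule someI_ex)
    define v where "v j = near (w j)" for j
    have "v \<in> S \<and> (\<exists>x. h (x, 0) = cl v)"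
    proof (rule boundary)
      show "v j \<in> \<gamma>" for j by (simp add: v_def near)
      show "eventually (\<lambda>j. mdist M2 (e (w j)) (\<phi> (v j)) \<le> B) \<omega>" by (simp add: v_def near)
      show "eventually (\<lambda>j. norm (w j) \<le> (c + (C * L + 1) + norm z) * scal j) \<omega>"
        using w P2[of z]
      proof eventually_elim
        case (elim j)
        have "dist (w j) (scal j *\<^sub>R z) \<le> mdist M2 (b z j) (e (w j)) + mdist M2 (b z j) (e (scal j *\<^sub>R z))"
          using mdist_triangle[of "e (w j)" M2 "b z j" "e (scal j *\<^sub>R z)"] bX
          by (simp add: mdist_commute[of M2 "e (w j)"])
        moreover have "norm (w j) \<le> dist (w j) (scal j *\<^sub>R z) + norm z * scal j"
          using norm_triangle_ineq[of "w j - scal j *\<^sub>R z" "scal j *\<^sub>R z"] scal(1)[of j]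
          by (simp add: dist_norm mult.commute)
        ultimately show ?case using elim by (simp add: algebra_simps)
      qed
    qed
    then obtain x where v: "v \<in> S" "h (x, 0) = cl v" by blast
    have "1 / L \<le> dist (G z, 1::real) (x, 0) / L"
      using L dist_snd_le[of "(G z, 1::real)" "(x, 0)"] by (intro divide_right_mono) auto
    also have "\<dots> \<le> mdist A (cl (a (G z))) (cl v)"
      using bil[of "(G z, 1)" "(x, 0)"] by (simp add: a v)
    also have "\<dots> \<le> C * c + C * 0"
    proof (rule tendsto_le[OF nb _ lim])
      show "((\<lambda>j. C * c + C * ((B + K) / scal j)) \<longlongrightarrow> C * c + C * 0) \<omega>"
        by (intro tendsto_intros small)
      show "eventually (\<lambda>j. mdist M1 (a (G z) j) (v j) / scal j \<le> C * c + C * ((B + K) / scal j)) \<omega>"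
        using w
      proof eventually_elim
        case (elim j)
        have vX: "v j \<in> mspace M1" by (rule SX[OF v(1)])
        have "mdist M2 (b z j) (\<phi> (v j)) \<le> mdist M2 (b z j) (e (w j)) + mdist M2 (e (w j)) (\<phi> (v j))"
          using bX \<phi>2[OF vX] by (intro mdist_triangle) auto
        then have "mdist M2 (b z j) (\<phi> (v j)) + K \<le> c * scal j + (B + K)"
          using elim near(2)[of "w j"] by (simp add: v_def)
        then have "C * (mdist M2 (b z j) (\<phi> (v j)) + K) \<le> C * (c * scal j + (B + K))"
          using C by (intro mult_left_mono) auto
        then have "mdist M1 (a (G z) j) (v j) \<le> C * (c * scal j + (B + K))"
          using lo[OF aX vX, of "G z" j] by (simp add: b_def)
        also have "\<dots> = (C * c + C * ((B + K) / scal j)) * scal j"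
          using scal(1)[of j] by (simp add: field_simps)
        finally show ?case using scal(1)[of j] by (simp add: divide_le_eq)
      qed
    qed (use a v in auto)
    also have "\<dots> = 1 / (2 * L)" using C L by (simp add: c_def)
    finally show False using L by (simp add: field_simps)
  qed
  have "0 < C * (L * (L * C))" "0 < C * L + 1" using C L by (simp_all add: add_pos_pos)
  with that[of b "C * (L * (L * C))" "C * L + 1" c] bX P1 P2 P3 c show ?thesis by blast
qed

theorem corollary5p1:
  fixes M1 :: "'a metric" and M2 :: "'b metric" and \<phi> :: "'a \<Rightarrow> 'b"
    and \<gamma> :: "'a set" and base :: 'a and \<omega> :: "nat filter" and scal :: "nat \<Rightarrow> real"
  assumes "CAT0 M1" and "mcomplete_of M1" and "locally_compact_space (mtopology_of M1)"
    and "CAT0 M2" and "mcomplete_of M2" and "locally_compact_space (mtopology_of M2)"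
    and "quasi_isometry M1 M2 \<phi>"
    and "is_flat TYPE('k::finite) M1 \<gamma>"
    and "nonprincipal_ultrafilter \<omega>"
    and "\<And>j. 0 < scal j" and "filterlim scal at_top \<omega>"
    and "base \<in> mspace M1"
    and "\<exists>F \<subseteq> mspace (asymptotic_cone \<omega> scal M1 base).
           bilipschitz_half_flat_bounding TYPE('k) (asymptotic_cone \<omega> scal M1 base) F
             (cone_subset \<omega> scal M1 base \<gamma>)"
  shows "(\<forall>\<eta>. is_flat TYPE('k) M2 \<eta> \<and> hausdorff_distance M2 \<eta> (\<phi> ` \<gamma>) < \<infinity> \<longrightarrow>
             \<not> compact_space (flat_quotient M2 \<eta>)) \<or>
         (\<forall>\<eta>. is_flat TYPE('k) M2 \<eta> \<and> hausdorff_distance M2 \<eta> (\<phi> ` \<gamma>) < \<infinity> \<longrightarrow>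
             bounds_half_flat TYPE('k) M2 \<eta>)"
proof (rule disjCI, intro allI impI)
  fix \<eta>
  assume "\<not> (\<forall>\<eta>. is_flat TYPE('k) M2 \<eta> \<and> hausdorff_distance M2 \<eta> (\<phi> ` \<gamma>) < \<infinity> \<longrightarrow>
             bounds_half_flat TYPE('k) M2 \<eta>)"
  then obtain \<eta>1 where \<eta>1: "is_flat TYPE('k) M2 \<eta>1" "hausdorff_distance M2 \<eta>1 (\<phi> ` \<gamma>) < \<infinity>"
    "\<not> bounds_half_flat TYPE('k) M2 \<eta>1" by blast
  assume \<eta>: "is_flat TYPE('k) M2 \<eta> \<and> hausdorff_distance M2 \<eta> (\<phi> ` \<gamma>) < \<infinity>"
  show "\<not> compact_space (flat_quotient M2 \<eta>)"
  proof
    assume cpt: "compact_space (flat_quotient M2 \<eta>)"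
    obtain e :: "real^'k \<Rightarrow> 'b" where e: "isometric_embedding euclidean_metric M2 e" "range e = \<eta>"
      using \<eta> unfolding is_flat_def by blast
    obtain e1 :: "real^'k \<Rightarrow> 'b" where e1: "isometric_embedding euclidean_metric M2 e1" "range e1 = \<eta>1"
      using \<eta>1(1) unfolding is_flat_def by blast
    interpret F: flat_in_cat0 M2 e by unfold_locales (fact assms(4) e(1))+
    interpret F1: flat_in_cat0 M2 e1 by unfold_locales (fact assms(4) e1(1))+
    have ultrafilter: "ultrafilter \<omega>" by (rule nonprincipal_ultra[OF assms(9)])
    have seq: "\<omega> \<le> sequentially" by (rule nonprincipal_le_sequentially[OF assms(9)])
    have \<gamma>: "\<gamma> \<subseteq> mspace M1"
      using assms(8) unfolding is_flat_def isometric_embedding_def by auto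
    obtain C K where qi: "1 \<le> C" "0 \<le> K" "quasi_isometric_map C K M1 M2 \<phi>"
      using assms(7) unfolding quasi_isometry_def by blast
    have \<phi>2: "\<phi> p \<in> mspace M2" if "p \<in> \<gamma>" for p
      using qi(3) \<gamma> that by (auto simp: quasi_isometric_map_def)
    obtain B where B: "\<And>x. x \<in> \<eta> \<Longrightarrow> \<exists>y\<in>\<phi> ` \<gamma>. mdist M2 x y \<le> B"
      "\<And>y. y \<in> \<phi> ` \<gamma> \<Longrightarrow> \<exists>x\<in>\<eta>. mdist M2 x y \<le> B"
      using hausdorff_finiteD[OF conjunct2[OF \<eta>]] by blast
    obtain B1 where B1: "\<And>x. x \<in> \<eta>1 \<Longrightarrow> \<exists>y\<in>\<phi> ` \<gamma>. mdist M2 x y \<le> B1"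
      using hausdorff_finiteD[OF \<eta>1(2)] by blast
    have parallel: "\<exists>y. mdist M2 (e1 x) (e y) \<le> B1 + B" for x
    proof -
      obtain p where p: "p \<in> \<gamma>" "mdist M2 (e1 x) (\<phi> p) \<le> B1" using B1[of "e1 x"] e1(2) by blast
      obtain y where y: "mdist M2 (e y) (\<phi> p) \<le> B" using B(2)[of "\<phi> p"] p(1) e(2) by blast
      have "mdist M2 (e1 x) (e y) \<le> mdist M2 (e1 x) (\<phi> p) + mdist M2 (\<phi> p) (e y)"
        using \<phi>2[OF p(1)] by (intro mdist_triangle) auto
      then show ?thesis using p y by (intro exI[of _ y]) (simp add: mdist_commute[of M2 "\<phi> p"])
    qed
    have near: "\<exists>p\<in>\<gamma>. mdist M2 (e x) (\<phi> p) \<le> B" for x using B(1)[of "e x"] e(2) by blast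
    obtain F where F: "bilipschitz_half_flat_bounding TYPE('k) (asymptotic_cone \<omega> scal M1 base) F
             (cone_subset \<omega> scal M1 base \<gamma>)" using assms(13) by blast
    have thick: "\<exists>q\<in>mspace M2. N \<le> mdist M2 q (e (F.proj q)) \<and> (\<exists>b'. cball b' R \<subseteq> F.sublevel q \<epsilon>)"
      if R\<epsilon>: "0 < R" "0 < \<epsilon>" for R \<epsilon> N
    proof (rule half_flat_sequences[OF assms(9-12) qi(3,1,2) \<gamma> F e(1) near])
      fix b :: "real^'k \<Rightarrow> nat \<Rightarrow> 'b" and \<Lambda> C' c :: real
      assume seqs: "\<And>z j. b z j \<in> mspace M2"
        "\<And>z z' \<delta>. 0 < \<delta> \<Longrightarrow> eventually (\<lambda>j. mdist M2 (b z j) (b z' j) \<le> (\<Lambda> * dist z z' + \<delta>) * scal j) \<omega>"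
        "\<And>z. eventually (\<lambda>j. mdist M2 (b z j) (e (scal j *\<^sub>R z)) \<le> C' * scal j) \<omega>"
        "\<And>z. eventually (\<lambda>j. \<forall>w. c * scal j \<le> mdist M2 (b z j) (e w)) \<omega>"
        "0 < \<Lambda>" "0 < C'" "0 < c"
      show ?thesis by (rule F.flat_sublevels[OF ultrafilter assms(10,11) seqs R\<epsilon>])
    qed
    obtain \<rho> where \<rho>: "\<And>x. \<exists>g\<in>stab M2 (range e). mdist M2 (g (e x)) (e 0) < \<rho>"
      using F.cocompact_stab cpt unfolding e(2)[symmetric] by blast
    obtain q where q: "\<And>n. q n \<in> mspace M2" "filterlim (\<lambda>n. mdist M2 (q n) (e 0)) at_top sequentially"
      "\<And>x. (\<lambda>n. mdist M2 (q n) (e x) - mdist M2 (q n) (e 0)) \<longlonglongrightarrow> 0"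
      using F.far_points_of_cocompact[OF \<rho> thick] by blast
    have equi1: "((\<lambda>n. mdist M2 (q n) (e1 x) - mdist M2 (q n) (e1 0)) \<longlongrightarrow> 0) \<omega>" for x
      by (rule F.far_points_parallel[OF ultrafilter q(1) tendsto_mono[OF seq q(3)] F1.flat_in_cat0_axioms parallel])
    have far1: "filterlim (\<lambda>n. mdist M2 (q n) (e1 0)) at_top \<omega>"
    proof -
      have "filterlim (\<lambda>n. - mdist M2 (e1 0) (e 0) + mdist M2 (q n) (e 0)) at_top \<omega>"
        by (intro filterlim_tendsto_add_at_top[OF tendsto_const] filterlim_mono[OF q(2) order_refl seq])
      moreover have "- mdist M2 (e1 0) (e 0) + mdist M2 (q n) (e 0) \<le> mdist M2 (q n) (e1 0)" for n
        using mdist_triangle[of "q n" M2 "e1 0" "e 0"] q(1) by simp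
      then have "eventually (\<lambda>n. - mdist M2 (e1 0) (e 0) + mdist M2 (q n) (e 0) \<le> mdist M2 (q n) (e1 0)) \<omega>"
        by simp
      ultimately show ?thesis by (rule filterlim_at_top_mono)
    qed
    have "bounds_half_flat TYPE('k) M2 (range e1)"
      by (rule F1.half_flat_of_far_points[OF ultrafilter F.Hopf_Rinow[OF assms(5,6) F1.e_in] q(1) far1 equi1])
    then show False using \<eta>1(3) e1(2) by simp
  qed
qed

end
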